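(* Let $F$ be an element of the second Wiener chaos with symmetric distribution (i.e. $F\overset{law}{=}-F$) such that $\mathbb E(F^2)\le1$, and let $N_1,N_2$ be independent $\mathscr N(0,1)$. Then: 1. for every integer $r\ge1$, $\kappa_{2r}(F)\le\kappa_{2r}(N_1\times N_2)$; 2. for every integer $r\ge1$, $\mu_{2r}(F)\le\mu_{2r}(N_1\times N_2)$; 3. if one of the cumulant or moment inequalities in items 1 or 2 is an equality for some $r\ge2$, then $F\overset{law}{=}N_1\times N_2$.
   Context: Let $W$ be an isonormal Gaussian process over a real separable Hilbert space $\mathfrak H$. The second Wiener chaos is $\mathscr H_2=\{I_2(f): f\in\mathfrak H^{\odot2}\}$ ($I_2$ the double Wiener integral). Equivalently, every $F\in\mathscr H_2$ can be written $F=\sum_{z\in\mathbb Z}\lambda_z(N_z^2-1)/\sqrt2$ with $(N_z)$ i.i.d. standard Gaussian and $\sum_z\lambda_z^2=\mathbb E(F^2)<\infty$. $\kappa_k$ denotes the $k$-th cumulant and $\mu_k(F)=\mathbb E(F^k)$ the $k$-th moment. *)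

theory Defs
  imports "HOL-Probability.Probability"
begin

section \<open>Isonormal Gaussian processes\<close>

text \<open>Degenerate (constant) Gaussian variables are included.\<close>

definition gaussian_rv :: "'a measure \<Rightarrow> ('a \<Rightarrow> real) \<Rightarrow> bool" where
  "gaussian_rv M X \<longleftrightarrow> X \<in> borel_measurable M \<and>
     ((\<exists>m. distr M borel X = return borel m) \<or>
      (\<exists>m s. 0 < s \<and> distributed M lborel X (normal_density m s)))"

definition gaussian_family :: "'a measure \<Rightarrow> ('i \<Rightarrow> 'a \<Rightarrow> real) \<Rightarrow> bool" where
  "gaussian_family M W \<longleftrightarrow>
     (\<forall>S c. finite S \<longrightarrow> gaussian_rv M (\<lambda>\<omega>. \<Sum>h\<in>S. c h * W h \<omega>))"

text \<open>A real separable Hilbert space is a type of sort \<open>{real_inner, polish_space}\<close>;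
  it may have finite dimension.\<close>

definition isonormal_process ::
  "'a measure \<Rightarrow> ('h::{real_inner, polish_space} \<Rightarrow> 'a \<Rightarrow> real) \<Rightarrow> bool" where
  "isonormal_process M W \<longleftrightarrow> prob_space M \<and> gaussian_family M W \<and>
     (\<forall>h. (\<integral>\<omega>. W h \<omega> \<partial>M) = 0) \<and>
     (\<forall>g h. (\<integral>\<omega>. W g \<omega> * W h \<omega> \<partial>M) = g \<bullet> h)"

section \<open>Symmetric tensors and the double Wiener integral\<close>

text \<open>An element \<open>f\<close> of the Hilbert tensor square of \<open>'h\<close> is identified with the
  Hilbert-Schmidt bilinear form \<open>(x, y) \<mapsto> \<langle>f, x \<otimes> y\<rangle>\<close>.  Its squared tensor norm is the sum of
  \<open>f(a, b)\<^sup>2\<close> over all \<open>a, b\<close> in an orthonormal basis, which is the supremum below.\<close>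

definition hs_norm_sq :: "('h::real_inner \<Rightarrow> 'h \<Rightarrow> real) \<Rightarrow> ennreal" where
  "hs_norm_sq f =
     (SUP S\<in>{S. finite S \<and> pairwise orthogonal S \<and> (\<forall>a\<in>S. norm a = 1)}.
        ennreal (\<Sum>a\<in>S. \<Sum>b\<in>S. (f a b)\<^sup>2))"

definition sym_tensors :: "('h::real_inner \<Rightarrow> 'h \<Rightarrow> real) set" where
  "sym_tensors = {f. bilinear f \<and> (\<forall>x y. f x y = f y x) \<and> hs_norm_sq f < \<infinity>}"

definition tensor_square :: "'h::real_inner \<Rightarrow> 'h \<Rightarrow> 'h \<Rightarrow> real" where
  "tensor_square h = (\<lambda>x y. (h \<bullet> x) * (h \<bullet> y))"

text \<open>The double integral is the continuous linear extension, from the dense span of the squares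
  \<open>h \<otimes> h\<close> to all symmetric tensors and with values in \<open>L\<^sup>2(M)\<close>, of
  \<open>I\<^sub>2(h \<otimes> h) = W(h)\<^sup>2 - \<parallel>h\<parallel>\<^sup>2\<close>.  As its values are defined only almost surely, it is given as a
  relation: \<open>F\<close> is a version of \<open>I\<^sub>2(f)\<close>.\<close>

definition is_double_wiener_integral ::
  "'a measure \<Rightarrow> ('h::{real_inner, polish_space} \<Rightarrow> 'a \<Rightarrow> real) \<Rightarrow>
     ('h \<Rightarrow> 'h \<Rightarrow> real) \<Rightarrow> ('a \<Rightarrow> real) \<Rightarrow> bool" where
  "is_double_wiener_integral M W f F \<longleftrightarrow>
     F \<in> borel_measurable M \<and> integrable M (\<lambda>\<omega>. (F \<omega>)\<^sup>2) \<and>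
     (\<exists>(m :: nat \<Rightarrow> nat) (c :: nat \<Rightarrow> nat \<Rightarrow> real) (h :: nat \<Rightarrow> nat \<Rightarrow> 'h).
        (\<lambda>n. hs_norm_sq (\<lambda>x y. f x y - (\<Sum>k<m n. c n k * tensor_square (h n k) x y)))
          \<longlonglongrightarrow> 0 \<and>
        (\<lambda>n. \<integral>\<omega>. (F \<omega> - (\<Sum>k<m n. c n k * ((W (h n k) \<omega>)\<^sup>2 - (norm (h n k))\<^sup>2)))\<^sup>2 \<partial>M)
          \<longlonglongrightarrow> 0)"

definition second_wiener_chaos ::
  "'a measure \<Rightarrow> ('h::{real_inner, polish_space} \<Rightarrow> 'a \<Rightarrow> real) \<Rightarrow> ('a \<Rightarrow> real) set" where
  "second_wiener_chaos M W = {F. \<exists>f\<in>sym_tensors. is_double_wiener_integral M W f F}"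

section \<open>Moments and cumulants\<close>

definition moment :: "'a measure \<Rightarrow> ('a \<Rightarrow> real) \<Rightarrow> nat \<Rightarrow> real" where
  "moment M X k = (\<integral>\<omega>. (X \<omega>) ^ k \<partial>M)"

text \<open>\<open>\<kappa>\<^sub>k(X) = (-\<i>)\<^sup>k (d/dt)\<^sup>k log E[exp(\<i> t X)]\<close> at \<open>t = 0\<close>.  The principal branch is harmless, since
  the characteristic function is close to \<open>1\<close> near \<open>0\<close>.  The value is real, so \<open>Re\<close> only adjusts
  the type.  It is meaningful when \<open>X\<close> has a finite moment of order \<open>k\<close>.\<close>

definition cumulant :: "'a measure \<Rightarrow> ('a \<Rightarrow> real) \<Rightarrow> nat \<Rightarrow> real" where
  "cumulant M X k =
     Re ((- \<i>) ^ k *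
       ((\<lambda>g t. vector_derivative g (at t)) ^^ k) (\<lambda>t::real. Ln (char (distr M borel X) t)) 0)"

end

theory Submission
  imports Defs "Jordan_Normal_Form.Schur_Decomposition" "HOL-Complex_Analysis.Complex_Analysis"
begin

text \<open>\<open>F\<close> is a mean square limit of finite quadratic forms \<open>Q = \<Sum>\<^sub>k c\<^sub>k (W(h\<^sub>k)\<^sup>2 - \<parallel>h\<^sub>k\<parallel>\<^sup>2)\<close>.  Gaussian integration
  by parts gives the cumulants of \<open>Q\<close>: for \<open>k \<ge> 2\<close> the \<open>k\<close>-th one is \<open>2\<^bsup>k-1\<^esup> (k-1)!\<close> times the trace of the
  \<open>k\<close>-th power of the matrix \<open>(c\<^sub>a \<langle>h\<^sub>a, h\<^sub>b\<rangle>)\<close>, that is, the \<open>k\<close>-th power sum of its (real) eigenvalues.  All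
  moments, hence all cumulants, converge to those of \<open>F\<close>; so no infinite-dimensional spectral theorem
  is needed.  By symmetry the limits of the odd power sums vanish, which forces the largest positive
  and the largest negative eigenvalue to have the same limiting size \<open>\<beta>\<close>, with \<open>2 \<beta>\<^sup>2 \<le> p\<^sub>2 \<le> 1/2\<close> for the
  limiting power sums \<open>p\<^sub>k\<close>.  Hence \<open>p\<^bsub>2r\<^esub> \<le> \<beta>\<^bsup>2r-2\<^esup> p\<^sub>2 \<le> 2 (1/2)\<^bsup>2r\<^esup>\<close>, the value for the spectrum
  \<open>{1/2, -1/2}\<close> of \<open>N\<^sub>1 N\<^sub>2\<close>, and equality for one \<open>r \<ge> 2\<close> forces \<open>\<beta> = 1/2\<close> and then equality of all cumulants.
  The moments are polynomials with nonnegative coefficients in the cumulants, and they grow slowly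
  enough to determine the law.\<close>

text \<open>The spectra of the approximating forms have unbounded length and their entries need not
  converge. What converges are the power sums and, along a subsequence, the two extreme entries;
  hence everything is phrased through these. Mean square convergence alone says nothing about higher
  moments. It does bound the second moments, these bound the power sum of order 2 and so all higher
  ones, and this gives bounds \<open>fact k * C ^ k\<close> on the moments that are uniform in the
  approximation. The same bound makes the moment generating function analytic in a strip, which is
  why the moments determine the law. Cumulants are treated through an algebraic recursion with the
  moments; they meet the logarithm of the characteristic function only in
  \<open>cumulant_eq\<close>. The spectrum {1/2, -1/2} comes from N1 N2 = (A^2 - 1)/2 - (B^2 - 1)/2,
  where A and B, the sum and the difference of N1 and N2 divided by sqrt 2, are independent standard
  normal. The variance is twice the power sum of order 2, so the assumption on the variance of F
  becomes a bound 1/2 on that power sum.\<close>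

section \<open>Moments and cumulants\<close>

text \<open>Coefficientwise form of M' = K' M for the exponential generating functions M of the
  moments and K = log M of the cumulants. It involves neither convergence nor division, leaves
  \<open>\<kappa> 0\<close> free, and over a general ring it covers real moments as well as complex
  derivatives.\<close>

definition moment_cumulant_rec :: "(nat \<Rightarrow> 'a::comm_ring_1) \<Rightarrow> (nat \<Rightarrow> 'a) \<Rightarrow> bool" where
  "moment_cumulant_rec m \<kappa> \<longleftrightarrow> m 0 = 1 \<and>
     (\<forall>n. m (Suc n) = (\<Sum>i\<le>n. of_nat (n choose i) * \<kappa> (Suc i) * m (n - i)))"

text \<open>The top cumulant occurs with coefficient 1, so the recursion can also be solved for the
  cumulants.\<close>

lemma moment_cumulant_rec_Suc:
  assumes "moment_cumulant_rec m \<kappa>"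
  shows "m (Suc n) = (\<Sum>i<n. of_nat (n choose i) * \<kappa> (Suc i) * m (n - i)) + \<kappa> (Suc n)"
  using assms by (simp add: moment_cumulant_rec_def lessThan_Suc_atMost[symmetric])

lemma cumulants_unique:
  assumes "moment_cumulant_rec m \<kappa>" "moment_cumulant_rec m \<kappa>'"
  shows "\<kappa> (Suc n) = \<kappa>' (Suc n)"
proof (induction n rule: less_induct)
  case (less n)
  have "(\<Sum>i<n. of_nat (n choose i) * \<kappa> (Suc i) * m (n - i)) = (\<Sum>i<n. of_nat (n choose i) * \<kappa>' (Suc i) * m (n - i))"
    using less by (intro sum.cong) auto
  then show ?case
    using moment_cumulant_rec_Suc[OF assms(1), of n] moment_cumulant_rec_Suc[OF assms(2), of n] by simp
qed

lemma moments_unique: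
  assumes "moment_cumulant_rec m \<kappa>" "moment_cumulant_rec m' \<kappa>'"
    and "\<And>n. \<kappa> (Suc n) = \<kappa>' (Suc n)"
  shows "m n = m' n"
proof (induction n rule: less_induct)
  case (less n)
  show ?case
  proof (cases n)
    case 0
    then show ?thesis using assms by (simp add: moment_cumulant_rec_def)
  next
    case (Suc k)
    have "(\<Sum>i\<le>k. of_nat (k choose i) * \<kappa> (Suc i) * m (k - i)) = (\<Sum>i\<le>k. of_nat (k choose i) * \<kappa>' (Suc i) * m' (k - i))"
      using less Suc assms(3) by (intro sum.cong) auto
    then show ?thesis using assms(1,2) Suc by (simp add: moment_cumulant_rec_def)
  qed
qed

text \<open>Since binomial coefficient times \<open>fact i * fact (k - i)\<close> is
  \<open>fact k\<close>, each of the \<open>k + 1\<close> summands is at most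
  \<open>fact k * C ^ Suc k\<close>. Their number supplies the missing factor of the next factorial,
  so the same \<open>C\<close> survives the induction.\<close>

lemma moment_bound:
  fixes m \<kappa> :: "nat \<Rightarrow> real"
  assumes "moment_cumulant_rec m \<kappa>" "0 \<le> C"
    and "\<And>n. \<bar>\<kappa> (Suc n)\<bar> \<le> fact n * C ^ Suc n"
  shows "\<bar>m n\<bar> \<le> fact n * C ^ n"
proof (induction n rule: less_induct)
  case (less n)
  show ?case
  proof (cases n)
    case 0
    then show ?thesis using assms by (simp add: moment_cumulant_rec_def)
  next
    case (Suc k)
    have "\<bar>m n\<bar> \<le> (\<Sum>i\<le>k. \<bar>of_nat (k choose i) * \<kappa> (Suc i) * m (k - i)\<bar>)"
      using assms(1) Suc by (simp add: moment_cumulant_rec_def)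
    also have "\<dots> \<le> (\<Sum>i\<le>k. fact k * C ^ Suc k)"
    proof (rule sum_mono)
      fix i assume i: "i \<in> {..k}"
      have "\<bar>of_nat (k choose i) * \<kappa> (Suc i) * m (k - i)\<bar> = of_nat (k choose i) * (\<bar>\<kappa> (Suc i)\<bar> * \<bar>m (k - i)\<bar>)"
        by (simp add: abs_mult)
      also have "\<dots> \<le> of_nat (k choose i) * ((fact i * C ^ Suc i) * (fact (k - i) * C ^ (k - i)))"
        using less[of "k - i"] Suc assms(2,3) by (intro mult_left_mono mult_mono) auto
      also have "\<dots> = (of_nat (fact i * fact (k - i) * (k choose i)) :: real) * C ^ (Suc i + (k - i))"
        by (simp add: power_add mult_ac)
      also have "\<dots> = fact k * C ^ Suc k"
        using i binomial_fact_lemma[of i k] by simp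
      finally show "\<bar>of_nat (k choose i) * \<kappa> (Suc i) * m (k - i)\<bar> \<le> fact k * C ^ Suc k" .
    qed
    also have "\<dots> = fact n * C ^ n" using Suc by (simp add: mult_ac)
    finally show ?thesis .
  qed
qed

text \<open>By induction every cumulant is a polynomial in the moments, so it converges with them;
  the recursion itself is closed under limits.\<close>

lemma tendsto_cumulants:
  fixes m :: "nat \<Rightarrow> nat \<Rightarrow> real"
  assumes rec: "\<And>j. moment_cumulant_rec (m j) (\<kappa> j)" and lim: "\<And>n. (\<lambda>j. m j n) \<longlonglongrightarrow> m' n"
  shows "\<exists>\<kappa>'. moment_cumulant_rec m' \<kappa>' \<and> (\<forall>n. (\<lambda>j. \<kappa> j (Suc n)) \<longlonglongrightarrow> \<kappa>' (Suc n))"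
proof -
  have "convergent (\<lambda>j. \<kappa> j (Suc n))" for n
  proof (induction n rule: less_induct)
    case (less n)
    have eq: "(\<lambda>j. \<kappa> j (Suc n)) = (\<lambda>j. m j (Suc n) - (\<Sum>i<n. of_nat (n choose i) * \<kappa> j (Suc i) * m j (n - i)))"
      using moment_cumulant_rec_Suc[OF rec, of _ n] by auto
    have c: "convergent (\<lambda>j. m j k)" for k using lim by (auto simp: convergent_def)
    show ?case unfolding eq
      by (intro convergent_diff convergent_sum convergent_mult convergent_const c less) auto
  qed
  then have lk: "(\<lambda>j. \<kappa> j (Suc n)) \<longlonglongrightarrow> lim (\<lambda>j. \<kappa> j (Suc n))" for n
    by (simp add: convergent_LIMSEQ_iff)
  define \<kappa>' where "\<kappa>' = (\<lambda>n. lim (\<lambda>j. \<kappa> j n))"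
  have "moment_cumulant_rec m' \<kappa>'"
    unfolding moment_cumulant_rec_def
  proof (intro conjI allI)
    have "(\<lambda>j. m j 0) = (\<lambda>j. 1)" using rec by (auto simp: moment_cumulant_rec_def)
    then show "m' 0 = 1" using lim[of 0] LIMSEQ_unique[OF _ tendsto_const] by simp
    fix n
    have "(\<lambda>j. m j (Suc n)) \<longlonglongrightarrow> (\<Sum>i\<le>n. of_nat (n choose i) * \<kappa>' (Suc i) * m' (n - i))"
      using rec unfolding moment_cumulant_rec_def \<kappa>'_def
      by (auto intro!: tendsto_intros lk lim)
    then show "m' (Suc n) = (\<Sum>i\<le>n. of_nat (n choose i) * \<kappa>' (Suc i) * m' (n - i))"
      using lim LIMSEQ_unique by blast
  qed
  then show ?thesis using lk unfolding \<kappa>'_def by blast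
qed

text \<open>The indices \<open>Suc i\<close> and \<open>k - i\<close> of a summand add up to the odd
  number \<open>Suc k\<close>, so one of them is odd and its factor vanishes.\<close>

lemma odd_cumulants_zero:
  fixes m :: "nat \<Rightarrow> 'a::comm_ring_1"
  assumes "moment_cumulant_rec m \<kappa>" and odd: "\<And>n. odd n \<Longrightarrow> m n = 0"
  shows "odd n \<Longrightarrow> \<kappa> n = 0"
proof (induction n rule: less_induct)
  case (less n)
  then obtain k where k: "n = Suc k" by (cases n) auto
  have "(\<Sum>i<k. of_nat (k choose i) * \<kappa> (Suc i) * m (k - i)) = 0"
  proof (rule sum.neutral, intro ballI)
    fix i assume "i \<in> {..<k}"
    then show "of_nat (k choose i) * \<kappa> (Suc i) * m (k - i) = 0"
      using less odd[of "k - i"] k by (cases "odd (Suc i)") auto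
  qed
  then show ?case using moment_cumulant_rec_Suc[OF assms(1), of k] k less.prems odd by simp
qed

lemma moments_mono:
  fixes m m' :: "nat \<Rightarrow> real"
  assumes "moment_cumulant_rec m \<kappa>" "moment_cumulant_rec m' \<kappa>'"
    and "\<And>n. 0 \<le> \<kappa> (Suc n)" "\<And>n. \<kappa> (Suc n) \<le> \<kappa>' (Suc n)"
  shows "0 \<le> m n \<and> m n \<le> m' n"
proof (induction n rule: less_induct)
  case (less n)
  show ?case
  proof (cases n)
    case 0
    then show ?thesis using assms by (simp add: moment_cumulant_rec_def)
  next
    case (Suc k)
    have "0 \<le> (\<Sum>i\<le>k. of_nat (k choose i) * \<kappa> (Suc i) * m (k - i))"
      using less Suc assms(3) by (intro sum_nonneg mult_nonneg_nonneg) auto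
    moreover have "(\<Sum>i\<le>k. of_nat (k choose i) * \<kappa> (Suc i) * m (k - i)) \<le> (\<Sum>i\<le>k. of_nat (k choose i) * \<kappa>' (Suc i) * m' (k - i))"
      using less Suc assms(3,4) by (intro sum_mono mult_mono mult_nonneg_nonneg) (auto intro: order_trans[OF assms(3,4)])
    ultimately show ?thesis using assms(1,2) Suc by (simp add: moment_cumulant_rec_def)
  qed
qed

text \<open>Each summand of the recursion for \<open>m\<close> is at most the corresponding one for
  \<open>m'\<close>. Equal sums therefore force equality in the top summands, which are the
  cumulants.\<close>

lemma moment_eq_imp_cumulant_eq:
  fixes m m' :: "nat \<Rightarrow> real"
  assumes "moment_cumulant_rec m \<kappa>" "moment_cumulant_rec m' \<kappa>'"
    and "\<And>n. 0 \<le> \<kappa> (Suc n)" "\<And>n. \<kappa> (Suc n) \<le> \<kappa>' (Suc n)" "m (Suc n) = m' (Suc n)"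
  shows "\<kappa> (Suc n) = \<kappa>' (Suc n)"
proof -
  note mono = moments_mono[OF assms(1-4)]
  have "(\<Sum>i<n. of_nat (n choose i) * \<kappa> (Suc i) * m (n - i)) \<le> (\<Sum>i<n. of_nat (n choose i) * \<kappa>' (Suc i) * m' (n - i))"
    using mono assms(3,4) by (intro sum_mono mult_mono mult_nonneg_nonneg) (auto intro: order_trans[OF assms(3,4)])
  then show ?thesis
    using moment_cumulant_rec_Suc[OF assms(1), of n] moment_cumulant_rec_Suc[OF assms(2), of n] assms(4)[of n] assms(5)
    by simp
qed

text \<open>These cumulants are the coefficients of -1/2 log(1 - t^2), the cumulant generating
  function of a product of two independent standard normal variables. Dividing the convolution sum
  \<open>S n\<close> by \<open>fact n\<close> turns the weights into 1 for odd \<open>i\<close> and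
  0 for even \<open>i\<close>; shifting the index by two then gives a recursion for \<open>S\<close>
  that matches the one for \<open>m\<close>. It has step two, hence the induction over pairs of
  neighbours.\<close>

lemma moment_cumulant_rec_normal_product:
  fixes m :: "nat \<Rightarrow> real"
  assumes "m 0 = 1" "m 1 = 0" "\<And>n. m (Suc (Suc n)) = (real (Suc n))\<^sup>2 * m n"
  shows "moment_cumulant_rec m (\<lambda>k. if even k then fact (k - 1) else 0)"
proof -
  let ?k = "\<lambda>k. if even k then fact (k - 1) else 0 :: real"
  define S where "S n = (\<Sum>i\<le>n. real (n choose i) * ?k (Suc i) * m (n - i))" for n
  have "m (Suc n) = S n \<and> m (Suc (Suc n)) = S (Suc n)" for n
  proof (induction n)
    case 0
    then show ?case using assms(3)[of 0] assms(1,2) by (simp add: S_def)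
  next
    case (Suc n)
    have "S (Suc (Suc n)) / fact (Suc (Suc n)) =
      (\<Sum>i\<le>Suc (Suc n). if odd i then m (Suc (Suc n) - i) / fact (Suc (Suc n) - i) else 0)"
      unfolding S_def sum_divide_distrib
      by (intro sum.cong) (auto simp: binomial_fact)
    also have "\<dots> = m (Suc n) / fact (Suc n) + (\<Sum>i\<le>n. if odd i then m (n - i) / fact (n - i) else 0)"
      by (simp add: sum.atMost_Suc_shift del: sum.atMost_Suc fact_Suc) (intro sum.cong; simp)
    also have "(\<Sum>i\<le>n. if odd i then m (n - i) / fact (n - i) else 0) = S n / fact n"
      unfolding S_def sum_divide_distrib
      by (intro sum.cong) (auto simp: binomial_fact)
    also have "m (Suc n) / fact (Suc n) + S n / fact n = m (Suc (Suc (Suc n))) / fact (Suc (Suc n))"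
    proof -
      have "x / (a * f) + x / f = (a + 1)\<^sup>2 * x / ((a + 1) * (a * f))" if "0 < a" "0 < f" for a f x :: real
      proof -
        have "(a + 1)\<^sup>2 * x / ((a + 1) * (a * f)) = (a + 1) * x / (a * f)"
          using that by (simp add: power2_eq_square)
        then show ?thesis using that by (simp add: field_simps)
      qed
      from this[of "real (Suc n)" "fact n" "S n"] show ?thesis
        using Suc assms(3)[of "Suc n"] by (simp add: add.commute)
    qed
    finally show ?case using Suc by simp
  qed
  then show ?thesis using assms(1) by (simp add: moment_cumulant_rec_def S_def)
qed

section \<open>Eigenvalues of a weighted Gram matrix\<close>

definition mtrace :: "'a::comm_semiring_0 mat \<Rightarrow> 'a" where
  "mtrace A = (\<Sum>i<dim_row A. A $$ (i, i))"

lemma mtrace_mult_commute: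
  assumes "A \<in> carrier_mat n m" "B \<in> carrier_mat m n"
  shows "mtrace (A * B) = mtrace (B * A)"
proof -
  have "mtrace (A * B) = (\<Sum>i<n. \<Sum>j<m. A $$ (i, j) * B $$ (j, i))"
    using assms by (auto simp: mtrace_def scalar_prod_def lessThan_atLeast0 intro!: sum.cong)
  also have "\<dots> = (\<Sum>j<m. \<Sum>i<n. A $$ (i, j) * B $$ (j, i))"
    by (rule sum.swap)
  also have "\<dots> = mtrace (B * A)"
    using assms by (auto simp: mtrace_def scalar_prod_def lessThan_atLeast0 mult.commute intro!: sum.cong)
  finally show ?thesis .
qed

lemma upper_triangular_pow:
  fixes B :: "'a::comm_semiring_1 mat"
  assumes B: "B \<in> carrier_mat n n" and U: "upper_triangular B"
  shows "upper_triangular (B ^\<^sub>m k) \<and> (\<forall>i<n. (B ^\<^sub>m k) $$ (i, i) = (B $$ (i, i)) ^ k)"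
proof (induction k)
  case 0
  then show ?case using B by auto
next
  case (Suc k)
  have C: "B ^\<^sub>m k \<in> carrier_mat n n" using B by simp
  have ent: "(B ^\<^sub>m Suc k) $$ (i, j) = (\<Sum>l<n. (B ^\<^sub>m k) $$ (i, l) * B $$ (l, j))"
    if "i < n" "j < n" for i j
    using that B C by (auto simp: scalar_prod_def lessThan_atLeast0 intro!: sum.cong)
  have z1: "(B ^\<^sub>m k) $$ (i, l) = 0" if "l < i" "i < n" for i l
    using Suc.IH that C by (auto simp: upper_triangular_def)
  have z2: "B $$ (i, l) = 0" if "l < i" "i < n" for i l
    using U that B by (auto simp: upper_triangular_def)
  have "(B ^\<^sub>m Suc k) $$ (i, j) = 0" if "j < i" "i < n" for i j
  proof -
    have "(B ^\<^sub>m k) $$ (i, l) * B $$ (l, j) = 0" if "l < n" for l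
      using z1[of l i] z2[of j l] that \<open>j < i\<close> \<open>i < n\<close> by (cases "l < i") auto
    then show ?thesis using ent[of i j] that by (simp del: pow_mat.simps)
  qed
  moreover have "(B ^\<^sub>m Suc k) $$ (i, i) = (B $$ (i, i)) ^ Suc k" if "i < n" for i
  proof -
    have "(B ^\<^sub>m k) $$ (i, l) * B $$ (l, i) = (if l = i then (B $$ (i, i)) ^ Suc k else 0)" if "l < n" for l
      using z1[of l i] z2[of i l] that \<open>i < n\<close> Suc.IH by (cases l i rule: linorder_cases) (auto simp: mult.commute)
    then have "(B ^\<^sub>m Suc k) $$ (i, i) = (\<Sum>l<n. if l = i then (B $$ (i, i)) ^ Suc k else 0)"
      using ent[of i i] that by (simp del: pow_mat.simps power.simps)
    then show ?thesis using that by (simp del: pow_mat.simps)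
  qed
  ultimately show ?case using B by (auto simp: upper_triangular_def simp del: pow_mat.simps power.simps)
qed

text \<open>Schur triangularisation A = P B Q: by cyclicity the trace of the k-th power of A is that
  of the k-th power of B, whose diagonal holds the k-th powers of the roots of the characteristic
  polynomial. The triangular form suits a matrix diag(c) G, which is in general not
  symmetric.\<close>

lemma mtrace_pow_eigenvalues:
  fixes A :: "complex mat"
  assumes A: "A \<in> carrier_mat n n"
  shows "\<exists>e. (\<forall>i<n. eigenvalue A (e i)) \<and> (\<forall>k. mtrace (A ^\<^sub>m k) = (\<Sum>i<n. e i ^ k))"
proof -
  obtain as where cA: "char_poly A = (\<Prod>a\<leftarrow>as. [:- a, 1:])" and len: "length as = n"
    using char_poly_factorized[OF A] by auto
  obtain B P Q where S: "schur_decomposition A as = (B, P, Q)"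
    by (cases "schur_decomposition A as") auto
  from schur_decomposition[OF A cA S]
  have sim: "similar_mat_wit A B P Q" and U: "upper_triangular B" and dB: "diag_mat B = as"
    by auto
  from similar_mat_witD2[OF A sim]
  have car: "B \<in> carrier_mat n n" "P \<in> carrier_mat n n" "Q \<in> carrier_mat n n" and QP: "Q * P = 1\<^sub>m n"
    by auto
  have nth: "B $$ (i, i) = as ! i" if "i < n" for i
    using dB that car by (auto simp: diag_mat_def)
  have "mtrace (A ^\<^sub>m k) = (\<Sum>i<n. (as ! i) ^ k)" for k
  proof -
    have Bk: "B ^\<^sub>m k \<in> carrier_mat n n" using car by simp
    have "mtrace (A ^\<^sub>m k) = mtrace (P * (B ^\<^sub>m k * Q))"
      using similar_mat_wit_pow_id[OF sim, of k] car Bk by (simp add: assoc_mult_mat[of _ n n _ n _ n])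
    also have "\<dots> = mtrace ((B ^\<^sub>m k * Q) * P)"
      using car Bk by (intro mtrace_mult_commute[of _ n n]) auto
    also have "(B ^\<^sub>m k * Q) * P = B ^\<^sub>m k"
      using car Bk QP by (simp add: assoc_mult_mat[of _ n n _ n _ n])
    also have "mtrace (B ^\<^sub>m k) = (\<Sum>i<n. (as ! i) ^ k)"
      using upper_triangular_pow[OF car(1) U, of k] Bk car nth unfolding mtrace_def by (intro sum.cong) auto
    finally show ?thesis .
  qed
  moreover have "eigenvalue A (as ! i)" if "i < n" for i
    unfolding eigenvalue_root_char_poly[OF A] cA poly_prod_list
    using that len by (auto simp: prod_list_zero_iff in_set_conv_nth intro!: image_eqI[of _ _ "as ! i"])
  ultimately show ?thesis by blast
qed

text \<open>The weights may have both signs, so diag(c) G cannot be symmetrised by a square root of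
  diag(c). Instead, put z = X + i Y for the combination of the \<open>h b\<close> with the
  coefficients of an eigenvector \<open>v\<close>, and \<open>u a\<close> for the inner product of
  \<open>h a\<close> with z. The eigenvalue equation reads c u = e v in each coordinate. Multiplying
  by the conjugate of \<open>u a\<close> and summing gives \<open>w = e * s\<close> with
  \<open>w\<close> real and \<open>s\<close> the squared norm of z. If \<open>s\<close> vanishes, so
  does \<open>u\<close>, and then \<open>e\<close> is 0 because \<open>v\<close> is nonzero.\<close>

lemma eigenvalue_diag_gram_real:
  fixes h :: "nat \<Rightarrow> 'h::real_inner" and c :: "nat \<Rightarrow> real"
  assumes "eigenvalue (mat n n (\<lambda>(a, b). complex_of_real (c a * inner (h a) (h b)))) e"
  shows "e \<in> \<real>"
proof -
  let ?A = "mat n n (\<lambda>(a, b). complex_of_real (c a * inner (h a) (h b)))"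
  obtain v where v: "v \<in> carrier_vec n" "v \<noteq> 0\<^sub>v n" and Av: "?A *\<^sub>v v = e \<cdot>\<^sub>v v"
    using assms by (auto simp: eigenvalue_def eigenvector_def)
  define x where "x a = Re (v $ a)" for a
  define y where "y a = Im (v $ a)" for a
  define X where "X = (\<Sum>b<n. x b *\<^sub>R h b)"
  define Y where "Y = (\<Sum>b<n. y b *\<^sub>R h b)"
  define u where "u a = Complex (inner (h a) X) (inner (h a) Y)" for a
  have vxy: "v $ a = Complex (x a) (y a)" for a by (simp add: x_def y_def)
  have ev: "complex_of_real (c a) * u a = e * v $ a" if "a < n" for a
  proof -
    have "(?A *\<^sub>v v) $ a = (\<Sum>b<n. complex_of_real (c a * inner (h a) (h b)) * v $ b)"
      using that v by (auto simp: scalar_prod_def lessThan_atLeast0 intro!: sum.cong)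
    also have "\<dots> = complex_of_real (c a) * u a"
      by (rule complex_eqI)
        (simp_all add: u_def X_def Y_def vxy inner_sum_right sum_distrib_left mult_ac)
    finally have "complex_of_real (c a) * u a = (e \<cdot>\<^sub>v v) $ a" unfolding Av by simp
    then show ?thesis using that v by simp
  qed
  define s where "s = inner X X + inner Y Y"
  define w where "w = (\<Sum>a<n. c a * (cmod (u a))\<^sup>2)"
  have s: "(\<Sum>a<n. cnj (u a) * v $ a) = complex_of_real s"
  proof (rule complex_eqI)
    have "inner X X = (\<Sum>a<n. inner (h a) X * x a)"
      by (subst (1) X_def) (simp add: inner_sum_left mult.commute)
    moreover have "inner Y Y = (\<Sum>a<n. inner (h a) Y * y a)"
      by (subst (1) Y_def) (simp add: inner_sum_left mult.commute)
    ultimately show "Re (\<Sum>a<n. cnj (u a) * v $ a) = Re (complex_of_real s)"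
      by (simp add: vxy u_def s_def sum.distrib)
    have "inner Y X = (\<Sum>a<n. inner (h a) X * y a)"
      by (subst (1) Y_def) (simp add: inner_sum_left mult.commute)
    moreover have "inner X Y = (\<Sum>a<n. inner (h a) Y * x a)"
      by (subst (1) X_def) (simp add: inner_sum_left mult.commute)
    ultimately show "Im (\<Sum>a<n. cnj (u a) * v $ a) = Im (complex_of_real s)"
      by (simp add: vxy u_def sum_subtractf inner_commute)
  qed
  have ws: "complex_of_real w = e * complex_of_real s"
  proof -
    have "e * complex_of_real s = (\<Sum>a<n. cnj (u a) * (e * v $ a))"
      unfolding s[symmetric] by (simp add: sum_distrib_left mult_ac)
    also have "\<dots> = (\<Sum>a<n. cnj (u a) * (complex_of_real (c a) * u a))"
      using ev by (intro sum.cong) auto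
    also have "\<dots> = complex_of_real w"
      unfolding w_def of_real_sum of_real_mult complex_norm_square
      by (intro sum.cong) (auto simp: mult_ac)
    finally show ?thesis by simp
  qed
  show ?thesis
  proof (cases "s = 0")
    case False
    then have "e = complex_of_real (w / s)" using ws by (simp add: field_simps)
    then show ?thesis by simp
  next
    case True
    then have "inner X X = 0" "inner Y Y = 0"
      using inner_ge_zero[of X] inner_ge_zero[of Y] unfolding s_def by linarith+
    then have "u a = 0" for a by (simp add: u_def complex_eq_iff)
    moreover obtain a where "a < n" "v $ a \<noteq> 0"
    proof (rule ccontr)
      assume "\<not> thesis"
      then have "v = 0\<^sub>v n" using that v(1) by (intro eq_vecI) auto
      then show False using v(2) by simp
    qed
    ultimately have "e = 0" using ev[of a] by simp
    then show ?thesis by simp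
  qed
qed

lemma mtrace_pow_diag_gram:
  fixes h :: "nat \<Rightarrow> 'h::real_inner" and c :: "nat \<Rightarrow> real"
  shows "\<exists>e :: nat \<Rightarrow> real. \<forall>k. mtrace (mat n n (\<lambda>(a, b). c a * inner (h a) (h b)) ^\<^sub>m k) = (\<Sum>i<n. e i ^ k)"
proof -
  let ?A = "mat n n (\<lambda>(a, b). c a * inner (h a) (h b))"
  let ?B = "mat n n (\<lambda>(a, b). complex_of_real (c a * inner (h a) (h b)))"
  have AB: "?B = map_mat complex_of_real ?A" by (rule eq_matI) auto
  obtain e where ev: "\<And>i. i < n \<Longrightarrow> eigenvalue ?B (e i)" and tr: "\<And>k. mtrace (?B ^\<^sub>m k) = (\<Sum>i<n. e i ^ k)"
    using mtrace_pow_eigenvalues[of ?B n] by auto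
  have "mtrace (?A ^\<^sub>m k) = (\<Sum>i<n. Re (e i) ^ k)" for k
  proof -
    have "?B ^\<^sub>m k = map_mat complex_of_real (?A ^\<^sub>m k)"
      unfolding AB by (rule of_real_hom.mat_hom_pow[symmetric, of _ n]) auto
    then have "complex_of_real (mtrace (?A ^\<^sub>m k)) = (\<Sum>i<n. e i ^ k)"
      using tr[of k] by (simp add: mtrace_def)
    also have "\<dots> = (\<Sum>i<n. complex_of_real (Re (e i)) ^ k)"
      using eigenvalue_diag_gram_real[OF ev] by (intro sum.cong) (auto simp: of_real_Re)
    finally have "complex_of_real (mtrace (?A ^\<^sub>m k)) = complex_of_real (\<Sum>i<n. Re (e i) ^ k)"
      by simp
    then show ?thesis by (simp only: of_real_eq_iff)
  qed
  then show ?thesis by (intro exI[of _ "\<lambda>i. Re (e i)"]) simp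
qed

section \<open>Limits of power sums\<close>

text \<open>No entry exceeds the l2 norm in size, so \<open>k - 2\<close> factors can be estimated
  by it. The bound does not depend on the number of entries, which is unbounded along the
  approximation.\<close>

lemma abs_power_sum_le:
  fixes e :: "'i \<Rightarrow> real"
  assumes "finite I" "2 \<le> k"
  shows "\<bar>\<Sum>i\<in>I. e i ^ k\<bar> \<le> sqrt (\<Sum>i\<in>I. (e i)\<^sup>2) ^ k"
proof -
  let ?B = "sqrt (\<Sum>i\<in>I. (e i)\<^sup>2)"
  obtain l where l: "k = l + 2" using assms(2) by (metis add.commute le_Suc_ex)
  have B2: "?B\<^sup>2 = (\<Sum>i\<in>I. (e i)\<^sup>2)" by (simp add: sum_nonneg)
  have e: "\<bar>e i\<bar> \<le> ?B" if "i \<in> I" for i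
    using member_le_sum[of i I "\<lambda>i. (e i)\<^sup>2"] that assms(1) by (simp add: real_le_rsqrt)
  have "\<bar>\<Sum>i\<in>I. e i ^ k\<bar> \<le> (\<Sum>i\<in>I. \<bar>e i ^ k\<bar>)" by (rule sum_abs)
  also have "\<dots> \<le> (\<Sum>i\<in>I. ?B ^ l * (e i)\<^sup>2)"
    unfolding l power_add abs_mult power_abs power2_abs
    by (intro sum_mono mult_right_mono power_mono e) auto
  also have "\<dots> = ?B ^ l * ?B\<^sup>2"
    unfolding B2 sum_distrib_left ..
  also have "\<dots> = ?B ^ k"
    unfolding l power_add ..
  finally show ?thesis .
qed

text \<open>Otherwise \<open>x = \<gamma> / \<beta>\<close> is less than 1, and dividing by
  \<open>\<beta> ^ (2 * q + 1)\<close> bounds the fixed positive number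
  \<open>\<beta>\<^sup>2\<close> by \<open>x ^ (2 * q + 1) * C\<close>, which tends to 0.\<close>

lemma le_if_odd_power_dominated:
  fixes \<beta> \<gamma> C :: real
  assumes "0 \<le> \<beta>" "0 \<le> \<gamma>" "0 \<le> C" and dom: "\<And>q. \<beta> ^ (2 * q + 3) \<le> \<gamma> ^ (2 * q + 1) * C"
  shows "\<beta> \<le> \<gamma>"
proof (rule ccontr)
  assume "\<not> \<beta> \<le> \<gamma>"
  then have lt: "\<gamma> < \<beta>" and b: "0 < \<beta>" using assms by auto
  define x where "x = \<gamma> / \<beta>"
  have x: "0 \<le> x" "x < 1" using lt b assms(2) by (auto simp: x_def)
  obtain n where n: "x ^ n < \<beta>\<^sup>2 / (C + 1)"
    using real_arch_pow_inv[of "\<beta>\<^sup>2 / (C + 1)" x] b x assms(3) by auto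
  have "\<beta>\<^sup>2 * \<beta> ^ (2 * n + 1) \<le> (x * \<beta>) ^ (2 * n + 1) * C"
    using dom[of n] b by (simp add: x_def power_add power2_eq_square power3_eq_cube mult_ac)
  then have "\<beta>\<^sup>2 \<le> x ^ (2 * n + 1) * C"
    using b by (simp add: power_mult_distrib mult_ac del: power_Suc)
  also have "\<dots> \<le> x ^ n * (C + 1)"
    using x assms(3) by (intro mult_mono power_decreasing) auto
  also have "\<dots> < \<beta>\<^sup>2" using n assms(3) by (simp add: field_simps)
  finally show False by simp
qed

text \<open>Size of the largest positive entry; applied to \<open>- e\<close> it measures the
  largest negative one. The inserted 0 is the value when no entry is positive, in particular for
  \<open>n = 0\<close>.\<close>

definition top_part :: "nat \<Rightarrow> (nat \<Rightarrow> real) \<Rightarrow> real" where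
  "top_part n e = Max (insert 0 (e ` {..<n}))"

lemma top_part_nonneg: "0 \<le> top_part n e"
  by (simp add: top_part_def)

lemma top_part_ge: "i < n \<Longrightarrow> e i \<le> top_part n e"
  by (simp add: top_part_def)

lemma top_part_attained: "top_part n e = 0 \<or> (\<exists>i<n. e i = top_part n e)"
  using Max_in[of "insert 0 (e ` {..<n})"] unfolding top_part_def by fastforce

text \<open>Two nonzero extremes are attained at different indices, since the entries there have
  opposite signs; the remaining even powers are nonnegative. An extreme that is 0 contributes
  nothing and may have no index, hence the four cases.\<close>

lemma even_power_sum_ge:
  assumes "even k" "0 < k"
  shows "top_part n e ^ k + top_part n (\<lambda>i. - e i) ^ k \<le> (\<Sum>i<n. e i ^ k)"
proof -
  let ?b = "top_part n e" and ?c = "top_part n (\<lambda>i. - e i)"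
  have sub: "(\<Sum>i\<in>J. e i ^ k) \<le> (\<Sum>i<n. e i ^ k)" if "J \<subseteq> {..<n}" for J
    using that assms by (intro sum_mono2) (auto simp: zero_le_even_power)
  have single: "e i ^ k \<le> (\<Sum>i<n. e i ^ k)" if "i < n" for i
    using sub[of "{i}"] that by simp
  have c_pow: "e i ^ k = ?c ^ k" if "- e i = ?c" for i
    using that assms by (metis power_minus_even)
  have nonneg: "0 \<le> (\<Sum>i<n. e i ^ k)" using sub[of "{}"] by simp
  consider "?b = 0" "?c = 0" | i where "?b = 0" "i < n" "- e i = ?c"
    | i where "?c = 0" "i < n" "e i = ?b"
    | i j where "?b \<noteq> 0" "?c \<noteq> 0" "i < n" "e i = ?b" "j < n" "- e j = ?c"
    using top_part_attained[of n e] top_part_attained[of n "\<lambda>i. - e i"] by auto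
  then show ?thesis
  proof cases
    case 1
    then show ?thesis using assms nonneg by (simp add: zero_power)
  next
    case (2 i)
    have "?b ^ k = 0" using 2(1) assms by (simp add: zero_power)
    then show ?thesis using single[OF 2(2)] c_pow[OF 2(3)] by linarith
  next
    case (3 i)
    have "?c ^ k = 0" using 3(1) assms by (simp add: zero_power)
    then show ?thesis using single[OF 3(2)] unfolding 3(3) by linarith
  next
    case (4 i j)
    then have "i \<noteq> j" using top_part_nonneg[of n e] top_part_nonneg[of n "\<lambda>i. - e i"] by auto
    then have "e i ^ k + e j ^ k \<le> (\<Sum>i<n. e i ^ k)" using sub[of "{i, j}"] 4(3,5) by simp
    then show ?thesis unfolding 4(4) c_pow[OF 4(6)] .
  qed
qed

lemma even_power_sum_le:
  "(\<Sum>i<n. e i ^ (2 * q + 2)) \<le> max (top_part n e) (top_part n (\<lambda>i. - e i)) ^ (2 * q) * (\<Sum>i<n. (e i)\<^sup>2)"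
proof -
  have "e i ^ (2 * q + 2) \<le> max (top_part n e) (top_part n (\<lambda>i. - e i)) ^ (2 * q) * (e i)\<^sup>2" if "i < n" for i
  proof -
    have "\<bar>e i\<bar> \<le> max (top_part n e) (top_part n (\<lambda>i. - e i))"
      using top_part_ge[OF that, of e] top_part_ge[OF that, of "\<lambda>i. - e i"] by auto
    then have "\<bar>e i\<bar> ^ (2 * q) \<le> max (top_part n e) (top_part n (\<lambda>i. - e i)) ^ (2 * q)"
      by (rule power_mono) simp
    then have "e i ^ (2 * q) \<le> max (top_part n e) (top_part n (\<lambda>i. - e i)) ^ (2 * q)"
      by (simp add: power_even_abs)
    then show ?thesis unfolding power_add by (rule mult_right_mono) simp
  qed
  then show ?thesis unfolding sum_distrib_left by (rule sum_mono) (simp only: lessThan_iff)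
qed

text \<open>Negative entries have size at most \<open>?c\<close>, so adding
  \<open>?c ^ (2 * q + 1) * (e i)\<^sup>2\<close> makes every summand nonnegative. All but the one
  of the largest entry can then be dropped.\<close>

lemma odd_power_sum_ge:
  "top_part n e ^ (2 * q + 3) - top_part n (\<lambda>i. - e i) ^ (2 * q + 1) * (\<Sum>i<n. (e i)\<^sup>2)
    \<le> (\<Sum>i<n. e i ^ (2 * q + 3))"
proof -
  let ?c = "top_part n (\<lambda>i. - e i)"
  have ge: "0 \<le> e i ^ (2 * q + 3) + ?c ^ (2 * q + 1) * (e i)\<^sup>2" if "i < n" for i
  proof (cases "0 \<le> e i")
    case True
    then show ?thesis using top_part_nonneg by (intro add_nonneg_nonneg) auto
  next
    case False
    have "(- e i) ^ (2 * q + 1) \<le> ?c ^ (2 * q + 1)"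
      using False top_part_ge[OF that, of "\<lambda>i. - e i"] by (intro power_mono) auto
    then have "0 \<le> e i ^ (2 * q + 1) + ?c ^ (2 * q + 1)" by simp
    then have "0 \<le> (e i ^ (2 * q + 1) + ?c ^ (2 * q + 1)) * (e i)\<^sup>2" by (rule mult_nonneg_nonneg) simp
    also have "(e i ^ (2 * q + 1) + ?c ^ (2 * q + 1)) * (e i)\<^sup>2 = e i ^ (2 * q + 3) + ?c ^ (2 * q + 1) * (e i)\<^sup>2"
      by (simp add: algebra_simps power_add power2_eq_square power3_eq_cube)
    finally show ?thesis .
  qed
  have "top_part n e ^ (2 * q + 3) \<le> (\<Sum>i<n. e i ^ (2 * q + 3) + ?c ^ (2 * q + 1) * (e i)\<^sup>2)"
  proof (cases "top_part n e = 0")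
    case True
    have "0 \<le> (\<Sum>i<n. e i ^ (2 * q + 3) + ?c ^ (2 * q + 1) * (e i)\<^sup>2)"
      by (rule sum_nonneg) (rule ge, simp only: lessThan_iff)
    then show ?thesis using True by (simp add: zero_power)
  next
    case False
    then obtain i where i: "i < n" "e i = top_part n e" using top_part_attained by blast
    have "top_part n e ^ (2 * q + 3) \<le> e i ^ (2 * q + 3) + ?c ^ (2 * q + 1) * (e i)\<^sup>2"
      using i top_part_nonneg[of n "\<lambda>i. - e i"] by simp
    also have "\<dots> \<le> (\<Sum>i<n. e i ^ (2 * q + 3) + ?c ^ (2 * q + 1) * (e i)\<^sup>2)"
      using ge i by (intro member_le_sum) auto
    finally show ?thesis .
  qed
  then show ?thesis by (simp add: sum.distrib sum_distrib_left)
qed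

text \<open>With \<open>b\<close>, \<open>c\<close> the limiting sizes of the largest positive and the largest negative entry, the
  limit \<open>p\<^bsub>2q+3\<^esub>\<close> is at least \<open>b\<^bsup>2q+3\<^esup> - c\<^bsup>2q+1\<^esup> p\<^sub>2\<close>; as it vanishes for every \<open>q\<close>, \<open>b\<close> cannot exceed \<open>c\<close>,
  and conversely.\<close>

lemma limit_power_sums:
  fixes e :: "nat \<Rightarrow> nat \<Rightarrow> real" and p :: "nat \<Rightarrow> real"
  assumes lim: "\<And>k. 2 \<le> k \<Longrightarrow> (\<lambda>j. \<Sum>i<N j. e j i ^ k) \<longlonglongrightarrow> p k"
    and odd: "\<And>k. odd k \<Longrightarrow> 3 \<le> k \<Longrightarrow> p k = 0"
    and p2: "p 2 \<le> 1 / 2"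
  shows "\<exists>\<beta>. 0 \<le> \<beta> \<and> \<beta> \<le> 1 / 2 \<and> (\<forall>r\<ge>1. 2 * \<beta> ^ (2 * r) \<le> p (2 * r) \<and> p (2 * r) \<le> \<beta> ^ (2 * r - 2) * p 2)"
proof -
  define b where "b j = top_part (N j) (e j)" for j
  define c where "c j = top_part (N j) (\<lambda>i. - e j i)" for j
  have p2': "(\<lambda>j. \<Sum>i<N j. (e j i)\<^sup>2) \<longlonglongrightarrow> p 2" using lim[of 2] by simp
  then obtain K where K: "\<And>j. \<bar>\<Sum>i<N j. (e j i)\<^sup>2\<bar> \<le> K"
    using convergent_imp_Bseq[OF convergentI[OF p2']] by (auto simp: Bseq_def)
  have bc: "0 \<le> b j" "0 \<le> c j" for j by (simp_all add: b_def c_def top_part_nonneg)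
  have sq: "(b j)\<^sup>2 + (c j)\<^sup>2 \<le> K" for j
    using even_power_sum_ge[of 2 "N j" "e j"] K[of j] by (simp add: b_def c_def)
  \<comment> \<open>The extreme entries are bounded but may oscillate. Passing to a subsequence
    leaves the limits \<open>p\<close> of the power sums unchanged.\<close>
  have "bounded (range (\<lambda>j. (b j, c j)))"
  proof (rule boundedI)
    fix x assume "x \<in> range (\<lambda>j. (b j, c j))"
    then obtain j where "x = (b j, c j)" by auto
    then show "norm x \<le> sqrt K" using sq[of j] by (simp add: norm_Pair)
  qed
  then obtain l s where s: "strict_mono s" and l: "((\<lambda>j. (b j, c j)) \<circ> s) \<longlonglongrightarrow> l"
    using bounded_imp_convergent_subsequence by blast
  define \<beta> where "\<beta> = fst l"
  define \<gamma> where "\<gamma> = snd l"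
  have lb: "(\<lambda>j. b (s j)) \<longlonglongrightarrow> \<beta>" and lc: "(\<lambda>j. c (s j)) \<longlonglongrightarrow> \<gamma>"
    using tendsto_fst[OF l] tendsto_snd[OF l] by (simp_all add: \<beta>_def \<gamma>_def comp_def)
  have nn: "0 \<le> \<beta>" "0 \<le> \<gamma>"
    using LIMSEQ_le_const[OF lb] LIMSEQ_le_const[OF lc] bc by auto
  have ls: "(\<lambda>j. \<Sum>i<N (s j). e (s j) i ^ k) \<longlonglongrightarrow> p k" if "2 \<le> k" for k
    using LIMSEQ_subseq_LIMSEQ[OF lim[OF that] s] by (simp add: comp_def)
  have ls2: "(\<lambda>j. \<Sum>i<N (s j). (e (s j) i)\<^sup>2) \<longlonglongrightarrow> p 2" using ls[of 2] by simp
  have p2nn: "0 \<le> p 2" using LIMSEQ_le_const[OF p2', of 0] by (simp add: sum_nonneg)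
  have even_ge: "\<beta> ^ (2 * r) + \<gamma> ^ (2 * r) \<le> p (2 * r)" if "1 \<le> r" for r
    using that even_power_sum_ge[of "2 * r"]
    by (intro LIMSEQ_le[OF tendsto_add[OF tendsto_power[OF lb] tendsto_power[OF lc]] ls])
      (auto simp: b_def c_def)
  have even_le: "p (2 * q + 2) \<le> max \<beta> \<gamma> ^ (2 * q) * p 2" for q
    using even_power_sum_le
    by (intro LIMSEQ_le[OF ls tendsto_mult[OF tendsto_power[OF tendsto_max[OF lb lc]] ls2]])
      (auto simp: b_def c_def)
  have dom1: "\<beta> ^ (2 * q + 3) \<le> \<gamma> ^ (2 * q + 1) * p 2" for q
  proof -
    have "\<beta> ^ (2 * q + 3) - \<gamma> ^ (2 * q + 1) * p 2 \<le> p (2 * q + 3)"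
      using odd_power_sum_ge
      by (intro LIMSEQ_le[OF tendsto_diff[OF tendsto_power[OF lb] tendsto_mult[OF tendsto_power[OF lc] ls2]] ls])
        (auto simp: b_def c_def)
    then show ?thesis using odd[of "2 * q + 3"] by simp
  qed
  have dom2: "\<gamma> ^ (2 * q + 3) \<le> \<beta> ^ (2 * q + 1) * p 2" for q
  proof -
    have "c j ^ (2 * q + 3) - b j ^ (2 * q + 1) * (\<Sum>i<N j. (e j i)\<^sup>2) \<le> - (\<Sum>i<N j. e j i ^ (2 * q + 3))" for j
      using odd_power_sum_ge[of "N j" "\<lambda>i. - e j i" q] by (simp add: b_def c_def sum_negf)
    then have "\<gamma> ^ (2 * q + 3) - \<beta> ^ (2 * q + 1) * p 2 \<le> - p (2 * q + 3)"
      by (intro LIMSEQ_le[OF tendsto_diff[OF tendsto_power[OF lc] tendsto_mult[OF tendsto_power[OF lb] ls2]]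
            tendsto_minus[OF ls]]) auto
    then show ?thesis using odd[of "2 * q + 3"] by simp
  qed
  have eq: "\<gamma> = \<beta>"
    using le_if_odd_power_dominated[OF nn p2nn dom1] le_if_odd_power_dominated[OF nn(2,1) p2nn dom2] by simp
  \<comment> \<open>The case \<open>r = 1\<close> of \<open>even_ge\<close> is twice the square of
    \<open>\<beta>\<close> on the left and at most 1/2 on the right.\<close>
  have "\<beta>\<^sup>2 \<le> (1 / 2)\<^sup>2" using even_ge[of 1] eq p2 by (simp add: power2_eq_square)
  then have "\<beta> \<le> 1 / 2" by (rule power2_le_imp_le) simp
  moreover have "2 * \<beta> ^ (2 * r) \<le> p (2 * r) \<and> p (2 * r) \<le> \<beta> ^ (2 * r - 2) * p 2" if "1 \<le> r" for r
  proof -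
    obtain q where q: "r = Suc q" using \<open>1 \<le> r\<close> by (metis Suc_le_D One_nat_def)
    show ?thesis using even_ge[OF that] even_le[of q] eq q by simp
  qed
  ultimately show ?thesis using nn(1) by blast
qed

text \<open>The bound is the value of \<open>\<beta> ^ (2 * r - 2) * (1 / 2)\<close> at
  \<open>\<beta> = 1 / 2\<close>. For \<open>r \<ge> 2\<close> the exponent is positive, so equality
  leaves only \<open>\<beta> = 1 / 2\<close>; then the lower bound
  \<open>2 * \<beta> ^ (2 * k)\<close> meets the upper bound for every \<open>k\<close>. For
  \<open>r = 1\<close> the exponent is 0 and equality says nothing about
  \<open>\<beta>\<close>.\<close>

lemma limit_power_sums_le:
  fixes e :: "nat \<Rightarrow> nat \<Rightarrow> real" and p :: "nat \<Rightarrow> real"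
  assumes lim: "\<And>k. 2 \<le> k \<Longrightarrow> (\<lambda>j. \<Sum>i<N j. e j i ^ k) \<longlonglongrightarrow> p k"
    and odd: "\<And>k. odd k \<Longrightarrow> 3 \<le> k \<Longrightarrow> p k = 0"
    and p2: "p 2 \<le> 1 / 2"
  shows "1 \<le> r \<Longrightarrow> 0 \<le> p (2 * r)"
    and "1 \<le> r \<Longrightarrow> p (2 * r) \<le> 2 * (1 / 2) ^ (2 * r)"
    and "2 \<le> r \<Longrightarrow> p (2 * r) = 2 * (1 / 2) ^ (2 * r) \<Longrightarrow> 1 \<le> k \<Longrightarrow> p (2 * k) = 2 * (1 / 2) ^ (2 * k)"
proof -
  obtain \<beta> where b: "0 \<le> \<beta>" "\<beta> \<le> 1 / 2" and lo: "\<And>r. 1 \<le> r \<Longrightarrow> 2 * \<beta> ^ (2 * r) \<le> p (2 * r)"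
    and hi: "\<And>r. 1 \<le> r \<Longrightarrow> p (2 * r) \<le> \<beta> ^ (2 * r - 2) * p 2"
    using limit_power_sums[OF assms] by auto
  have hi': "p (2 * r) \<le> \<beta> ^ (2 * r - 2) * (1 / 2)" if "1 \<le> r" for r
    using mult_left_mono[OF p2, of "\<beta> ^ (2 * r - 2)"] hi[OF that] b by auto
  have half: "2 * (1 / 2) ^ (2 * r) = (1 / 2) ^ (2 * r - 2) * (1 / 2 :: real)" if "1 \<le> r" for r :: nat
  proof -
    obtain q where "r = Suc q" using \<open>1 \<le> r\<close> by (metis Suc_le_D One_nat_def)
    then show ?thesis by simp
  qed
  show "0 \<le> p (2 * r)" if "1 \<le> r" using lo[OF that] zero_le_power[OF b(1), of "2 * r"] by linarith
  show le: "p (2 * r) \<le> 2 * (1 / 2) ^ (2 * r)" if "1 \<le> r" for r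
    using hi'[OF that] half[OF that] power_mono[OF b(2,1), of "2 * r - 2"] by linarith
  show "p (2 * k) = 2 * (1 / 2) ^ (2 * k)" if "2 \<le> r" "p (2 * r) = 2 * (1 / 2) ^ (2 * r)" "1 \<le> k"
  proof -
    have "\<beta> = 1 / 2"
    proof (rule ccontr)
      assume "\<beta> \<noteq> 1 / 2"
      then have "\<beta> ^ (2 * r - 2) < (1 / 2) ^ (2 * r - 2)"
        using b that(1) by (intro power_strict_mono) auto
      then show False using hi'[of r] half[of r] that by simp
    qed
    show ?thesis
      using lo[OF that(3)] le[OF that(3)] unfolding \<open>\<beta> = 1 / 2\<close> by (rule order.antisym[rotated])
  qed
qed

section \<open>Gaussian integration by parts\<close>

text \<open>Even exponents keep the integrands nonnegative, so closure under sums and products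
  reduces to pointwise bounds. Odd powers follow from \<open>all_moments_power\<close> and
  \<open>all_moments_integrable\<close>.\<close>

definition all_moments :: "'a measure \<Rightarrow> ('a \<Rightarrow> real) \<Rightarrow> bool" where
  "all_moments M f \<longleftrightarrow> f \<in> borel_measurable M \<and> (\<forall>k. integrable M (\<lambda>x. f x ^ (2 * k)))"

lemma abs_le_1_plus_square: "\<bar>x\<bar> \<le> 1 + x\<^sup>2" for x :: real
proof -
  have "0 \<le> (\<bar>x\<bar> - 1)\<^sup>2" by simp
  then have "2 * \<bar>x\<bar> \<le> 1 + x\<^sup>2" by (simp add: power2_eq_square algebra_simps)
  then show ?thesis by simp
qed

section \<open>Random variables with moments of all orders, among them the Gaussian ones\<close>

context prob_space
begin

lemma all_moments_measurable: "all_moments M f \<Longrightarrow> f \<in> borel_measurable M"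
  by (simp add: all_moments_def)

lemma all_moments_const: "all_moments M (\<lambda>_. c)"
  by (simp add: all_moments_def)

lemma all_moments_mult:
  assumes "all_moments M f" "all_moments M g"
  shows "all_moments M (\<lambda>x. f x * g x)"
  unfolding all_moments_def
proof (intro conjI allI)
  have [measurable]: "f \<in> borel_measurable M" "g \<in> borel_measurable M"
    using assms by (auto simp: all_moments_def)
  show "(\<lambda>x. f x * g x) \<in> borel_measurable M" by simp
  fix k
  have "integrable M (\<lambda>x. f x ^ (2 * (2 * k)) + g x ^ (2 * (2 * k)))"
    using assms unfolding all_moments_def by (intro Bochner_Integration.integrable_add) blast+
  then show "integrable M (\<lambda>x. (f x * g x) ^ (2 * k))"
  proof (rule Bochner_Integration.integrable_bound)
    show "AE x in M. norm ((f x * g x) ^ (2 * k)) \<le> norm (f x ^ (2 * (2 * k)) + g x ^ (2 * (2 * k)))"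
    proof (rule AE_I2)
      fix x
      define a where "a = f x ^ (2 * k)"
      define b where "b = g x ^ (2 * k)"
      have "0 \<le> a" "0 \<le> b" by (auto simp: a_def b_def zero_le_even_power)
      moreover have "0 \<le> (a - b)\<^sup>2" by simp
      moreover have "(a - b)\<^sup>2 = a\<^sup>2 + b\<^sup>2 - 2 * (a * b)" by (simp add: power2_eq_square algebra_simps)
      moreover have "0 \<le> a * b" using \<open>0 \<le> a\<close> \<open>0 \<le> b\<close> by simp
      ultimately have "a * b \<le> a\<^sup>2 + b\<^sup>2" "0 \<le> a * b"
        by linarith+
      then show "norm ((f x * g x) ^ (2 * k)) \<le> norm (f x ^ (2 * (2 * k)) + g x ^ (2 * (2 * k)))"
        unfolding a_def b_def power_mult_distrib power_mult[symmetric] power2_eq_square[symmetric]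
        by (simp add: mult.commute[of _ 2])
    qed
  qed simp
qed

lemma all_moments_add:
  assumes "all_moments M f" "all_moments M g"
  shows "all_moments M (\<lambda>x. f x + g x)"
  unfolding all_moments_def
proof (intro conjI allI)
  have [measurable]: "f \<in> borel_measurable M" "g \<in> borel_measurable M"
    using assms by (auto simp: all_moments_def)
  show "(\<lambda>x. f x + g x) \<in> borel_measurable M" by simp
  fix k
  have "integrable M (\<lambda>x. 2 ^ (2 * k) * (f x ^ (2 * k) + g x ^ (2 * k)))"
    using assms unfolding all_moments_def
    by (intro integrable_mult_right Bochner_Integration.integrable_add) blast+
  then show "integrable M (\<lambda>x. (f x + g x) ^ (2 * k))"
  proof (rule Bochner_Integration.integrable_bound)
    show "AE x in M. norm ((f x + g x) ^ (2 * k)) \<le> norm (2 ^ (2 * k) * (f x ^ (2 * k) + g x ^ (2 * k)))"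
    proof (rule AE_I2)
      fix x
      define m where "m = max \<bar>f x\<bar> \<bar>g x\<bar>"
      have "(f x + g x) ^ (2 * k) = \<bar>f x + g x\<bar> ^ (2 * k)" by (simp add: power_even_abs)
      also have "\<dots> \<le> (2 * m) ^ (2 * k)" by (intro power_mono) (auto simp: m_def)
      also have "\<dots> = 2 ^ (2 * k) * m ^ (2 * k)" by (rule power_mult_distrib)
      also have "m ^ (2 * k) \<le> f x ^ (2 * k) + g x ^ (2 * k)"
        by (auto simp: m_def max_def power_even_abs zero_le_even_power)
      finally show "norm ((f x + g x) ^ (2 * k)) \<le> norm (2 ^ (2 * k) * (f x ^ (2 * k) + g x ^ (2 * k)))"
        by (simp add: zero_le_even_power abs_mult)
    qed
  qed simp
qed

lemma all_moments_sum: "(\<And>i. i \<in> I \<Longrightarrow> all_moments M (f i)) \<Longrightarrow> all_moments M (\<lambda>x. \<Sum>i\<in>I. f i x)"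
proof (induction I rule: infinite_finite_induct)
  case (insert i I)
  then show ?case using all_moments_add[of "f i" "\<lambda>x. \<Sum>i\<in>I. f i x"] by simp
qed (simp_all add: all_moments_const)

lemma all_moments_diff: "all_moments M f \<Longrightarrow> all_moments M g \<Longrightarrow> all_moments M (\<lambda>x. f x - g x)"
  using all_moments_add[of f "\<lambda>x. (-1) * g x"] all_moments_mult[of "\<lambda>_. -1" g] all_moments_const
  by simp

lemma all_moments_power: "all_moments M f \<Longrightarrow> all_moments M (\<lambda>x. f x ^ k)"
proof (induction k)
  case (Suc k)
  then show ?case using all_moments_mult[of f "\<lambda>x. f x ^ k"] by simp
qed (simp add: all_moments_const)

lemma all_moments_integrable:
  assumes "all_moments M f"
  shows "integrable M f"
proof (rule Bochner_Integration.integrable_bound)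
  have "integrable M (\<lambda>x. f x ^ (2 * 1))" using assms unfolding all_moments_def by blast
  then show "integrable M (\<lambda>x. 1 + (f x)\<^sup>2)" by simp
  show "AE x in M. norm (f x) \<le> norm (1 + (f x)\<^sup>2)"
    using abs_le_1_plus_square by (auto simp: abs_of_nonneg)
qed (use assms in \<open>simp add: all_moments_def\<close>)

lemmas all_moments_intros =
  all_moments_const all_moments_mult all_moments_add all_moments_diff all_moments_sum all_moments_power

lemma integrable_iexp_mult:
  assumes "all_moments M f" "X \<in> borel_measurable M"
  shows "integrable M (\<lambda>x. complex_of_real (f x) * iexp (X x))"
proof (rule Bochner_Integration.integrable_bound)
  show "integrable M f" using assms(1) by (rule all_moments_integrable)
qed (use assms in \<open>auto simp: norm_mult all_moments_def\<close>)

lemma gaussian_rv_all_moments: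
  assumes "gaussian_rv M X"
  shows "all_moments M X"
proof -
  have [measurable]: "X \<in> borel_measurable M" using assms by (simp add: gaussian_rv_def)
  consider m where "distr M borel X = return borel m"
    | m s where "0 < s" "distributed M lborel X (normal_density m s)"
    using assms by (auto simp: gaussian_rv_def)
  then show ?thesis
  proof cases
    case (1 m)
    have "integrable M (\<lambda>x. X x ^ (2 * k))" for k
    proof -
      interpret R: prob_space "return borel m" by (rule prob_space_return) simp
      have "AE y in return borel m. y ^ (2 * k) = m ^ (2 * k)"
        by (subst AE_return) auto
      then have "integrable (return borel m) (\<lambda>y. y ^ (2 * k)) \<longleftrightarrow> integrable (return borel m) (\<lambda>y. m ^ (2 * k))"
        by (intro integrable_cong_AE) auto
      then have "integrable (distr M borel X) (\<lambda>y. y ^ (2 * k))"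
        unfolding 1 by simp
      then show ?thesis by (subst (asm) integrable_distr_eq) auto
    qed
    then show ?thesis by (simp add: all_moments_def)
  next
    case (2 m s)
    have "integrable M (\<lambda>x. (X x - m) ^ (2 * k))" for k
      using distributed_integrable[OF 2(2), of "\<lambda>y. (y - m) ^ (2 * k)"] integrable_normal_moment[OF 2(1), of m "2 * k"]
      by (simp add: normal_density_nonneg)
    then have "all_moments M (\<lambda>x. X x - m)" by (simp add: all_moments_def)
    then have "all_moments M (\<lambda>x. (X x - m) + m)" by (intro all_moments_add all_moments_const)
    then show ?thesis by simp
  qed
qed

lemma gaussian_rv_char:
  assumes G: "gaussian_rv M X" and mean: "expectation X = 0" and var: "expectation (\<lambda>x. (X x)\<^sup>2) = v"
  shows "(CLINT x|M. iexp (X x)) = exp (- v / 2)"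
proof -
  have [measurable]: "X \<in> borel_measurable M" using assms by (simp add: gaussian_rv_def)
  consider m where "distr M borel X = return borel m"
    | m s where "0 < s" "distributed M lborel X (normal_density m s)"
    using assms by (auto simp: gaussian_rv_def)
  then show ?thesis
  proof cases
    case (1 m)
    have *: "(\<integral>x. g (X x) \<partial>M) = g m" if [measurable]: "g \<in> borel_measurable borel"
      for g :: "real \<Rightarrow> 'z::{banach, second_countable_topology}"
      using integral_return[of m borel g] by (subst integral_distr[symmetric, of X M borel]) (auto simp: 1)
    have "m = 0" using *[of "\<lambda>y. y"] mean by simp
    moreover have "v = m\<^sup>2" using *[of "\<lambda>y. y\<^sup>2"] var by simp
    ultimately show ?thesis using *[of iexp] by simp
  next
    case (2 m s)
    have m: "m = 0" using normal_distributed_expectation[OF 2] mean by simp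
    have v: "v = s\<^sup>2" using normal_distributed_variance[OF 2] mean var by simp
    \<comment> \<open>Standardisation: the characteristic function of \<open>X\<close> at 1 is that
      of \<open>X / s\<close> at \<open>s\<close>.\<close>
    have D: "distributed M lborel (\<lambda>x. X x / s) std_normal_density"
      using 2(2) normal_standard_normal_convert[OF 2(1), of X m] m by simp
    have "distr M borel (\<lambda>x. X x / s) = std_normal_distribution"
      using distributed_distr_eq_density[OF D] by (simp add: distr_cong[of M M borel lborel])
    then have "char (distr M borel (\<lambda>x. X x / s)) s = exp (- (s\<^sup>2) / 2)"
      by (simp add: char_std_normal_distribution)
    moreover have "char (distr M borel (\<lambda>x. X x / s)) s = (CLINT x|M. iexp (X x))"
      using 2(1) unfolding char_def by (subst integral_distr) auto
    ultimately show ?thesis using v by simp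
  qed
qed

end

lemma has_vector_derivative_quadratic_bound:
  fixes g :: "real \<Rightarrow> 'z::real_normed_vector"
  assumes "\<And>t. norm (g t - g 0 - t *\<^sub>R D) \<le> C * t\<^sup>2"
  shows "(g has_vector_derivative D) (at 0)"
  unfolding has_vector_derivative_def has_derivative_at_within
proof (intro conjI bounded_linear_scaleR_left)
  have "((\<lambda>y. C * \<bar>y\<bar>) \<longlongrightarrow> C * \<bar>0\<bar>) (at 0)" by (intro tendsto_intros)
  then have "((\<lambda>y. C * \<bar>y\<bar>) \<longlongrightarrow> 0) (at 0)" by simp
  then show "((\<lambda>y. (g y - g 0 - (y - 0) *\<^sub>R D) /\<^sub>R norm (y - 0)) \<longlongrightarrow> 0) (at 0)"
  proof (rule Lim_null_comparison[rotated])
    have "norm ((g y - g 0 - (y - 0) *\<^sub>R D) /\<^sub>R norm (y - 0)) \<le> C * \<bar>y\<bar>" if "y \<noteq> 0" for y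
    proof -
      have cancel: "C * (a * a) / a = C * a" if "a \<noteq> 0" for a :: real
        using that by simp
      have "norm ((g y - g 0 - (y - 0) *\<^sub>R D) /\<^sub>R norm (y - 0)) = norm (g y - g 0 - y *\<^sub>R D) / \<bar>y\<bar>"
        by (simp add: divide_inverse mult.commute)
      also have "\<dots> \<le> C * y\<^sup>2 / \<bar>y\<bar>" by (intro divide_right_mono assms) simp
      also have "\<dots> = C * (\<bar>y\<bar> * \<bar>y\<bar>) / \<bar>y\<bar>" by (simp add: power2_eq_square)
      also have "\<dots> = C * \<bar>y\<bar>" by (rule cancel) (simp add: that)
      finally show ?thesis .
    qed
    then show "\<forall>\<^sub>F y in at 0. norm ((g y - g 0 - (y - 0) *\<^sub>R D) /\<^sub>R norm (y - 0)) \<le> C * \<bar>y\<bar>"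
      by (auto simp: eventually_at_filter)
  qed
qed

section \<open>Centred Gaussian processes with inner product covariance\<close>

locale gaussian_process = prob_space M for M :: "'a measure" +
  fixes W :: "'h::real_inner \<Rightarrow> 'a \<Rightarrow> real"
  assumes family: "gaussian_family M W"
    and mean: "expectation (W h) = 0"
    and cov: "expectation (\<lambda>\<omega>. W g \<omega> * W h \<omega>) = inner g h"
begin

lemma W_gaussian: "gaussian_rv M (W h)"
  using family[unfolded gaussian_family_def, rule_format, of "{h}" "\<lambda>_. 1"] by simp

lemma W_all_moments: "all_moments M (W h)"
  by (rule gaussian_rv_all_moments[OF W_gaussian])

lemma W_measurable [measurable]: "W h \<in> borel_measurable M"
  by (rule all_moments_measurable[OF W_all_moments])

lemma W_char: "(CLINT \<omega>|M. iexp (W h \<omega>)) = exp (- inner h h / 2)"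
  using gaussian_rv_char[OF W_gaussian mean] cov[of h h] by (simp add: power2_eq_square)

text \<open>Linearity is not part of the definition of the process. The covariance makes the mean
  square of the defect equal to the squared norm of \<open>?u - h - t *\<^sub>R v\<close>, which is
  0.\<close>

lemma W_linear: "AE \<omega> in M. W (h + t *\<^sub>R v) \<omega> = W h \<omega> + t * W v \<omega>"
proof -
  let ?u = "h + t *\<^sub>R v"
  let ?D = "\<lambda>\<omega>. W ?u \<omega> - (W h \<omega> + t * W v \<omega>)"
  note am = all_moments_intros W_all_moments
  have int: "integrable M (\<lambda>\<omega>. W a \<omega> * W b \<omega>)" for a b
    by (intro all_moments_integrable am)
  have "expectation (\<lambda>\<omega>. (?D \<omega>)\<^sup>2) = expectation (\<lambda>\<omega>. W ?u \<omega> * W ?u \<omega> + W h \<omega> * W h \<omega> + t * t * (W v \<omega> * W v \<omega>)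
      - 2 * (W ?u \<omega> * W h \<omega>) - 2 * t * (W ?u \<omega> * W v \<omega>) + 2 * t * (W h \<omega> * W v \<omega>))"
    by (intro Bochner_Integration.integral_cong) (auto simp: power2_eq_square algebra_simps)
  also have "\<dots> = inner ?u ?u + inner h h + t * t * inner v v - 2 * inner ?u h - 2 * t * inner ?u v + 2 * t * inner h v"
    using int by (simp add: cov)
  also have "\<dots> = 0"
    by (simp add: inner_add_left inner_add_right inner_commute algebra_simps)
  finally have "expectation (\<lambda>\<omega>. (?D \<omega>)\<^sup>2) = 0" .
  moreover have "integrable M (\<lambda>\<omega>. (?D \<omega>)\<^sup>2)" by (intro all_moments_integrable am)
  ultimately have "AE \<omega> in M. (?D \<omega>)\<^sup>2 = 0"
    by (subst (asm) integral_nonneg_eq_0_iff_AE) auto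
  then show ?thesis by eventually_elim simp
qed

text \<open>Differentiation under the expectation. After \<open>W_linear\<close> the first order
  Taylor remainder of exp(i x) at \<open>x = t * W v \<omega>\<close> is at most half of x^2, and
  the resulting multiple of t^2 has an integrable factor because \<open>f\<close> and
  \<open>W v\<close> have all moments.\<close>

lemma iexp_expectation_has_derivative:
  assumes f: "all_moments M f"
  shows "((\<lambda>t. CLINT \<omega>|M. complex_of_real (f \<omega>) * iexp (W (h + t *\<^sub>R v) \<omega>)) has_vector_derivative
     \<i> * (CLINT \<omega>|M. complex_of_real (f \<omega> * W v \<omega>) * iexp (W h \<omega>))) (at 0)"
proof (rule has_vector_derivative_quadratic_bound)
  fix t :: real
  note am = all_moments_intros W_all_moments f
  have [measurable]: "f \<in> borel_measurable M" using f by (rule all_moments_measurable)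
  let ?E = "\<lambda>t. CLINT \<omega>|M. complex_of_real (f \<omega>) * iexp (W (h + t *\<^sub>R v) \<omega>)"
  let ?D = "\<i> * (CLINT \<omega>|M. complex_of_real (f \<omega> * W v \<omega>) * iexp (W h \<omega>))"
  let ?r = "\<lambda>\<omega>. complex_of_real (f \<omega>) * iexp (W h \<omega> + t * W v \<omega>) - complex_of_real (f \<omega>) * iexp (W h \<omega>)
       - (\<i> * of_real t) * (complex_of_real (f \<omega> * W v \<omega>) * iexp (W h \<omega>))"
  have Et: "?E t = (CLINT \<omega>|M. complex_of_real (f \<omega>) * iexp (W h \<omega> + t * W v \<omega>))"
  proof (rule integral_cong_AE)
    show "AE \<omega> in M. complex_of_real (f \<omega>) * iexp (W (h + t *\<^sub>R v) \<omega>) = complex_of_real (f \<omega>) * iexp (W h \<omega> + t * W v \<omega>)"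
      using W_linear[of h t v] by eventually_elim simp
  qed auto
  have i1: "integrable M (\<lambda>\<omega>. complex_of_real (f \<omega>) * iexp (W h \<omega> + t * W v \<omega>))"
    by (intro integrable_iexp_mult am) auto
  have i2: "integrable M (\<lambda>\<omega>. complex_of_real (f \<omega>) * iexp (W h \<omega>))"
    by (intro integrable_iexp_mult am) auto
  have i3: "integrable M (\<lambda>\<omega>. complex_of_real (f \<omega> * W v \<omega>) * iexp (W h \<omega>))"
    by (intro integrable_iexp_mult am) auto
  have "?E t - ?E 0 - t *\<^sub>R ?D = (CLINT \<omega>|M. ?r \<omega>)"
    unfolding Et using i1 i2 i3 by (simp add: scaleR_conv_of_real mult_ac)
  moreover have "norm (CLINT \<omega>|M. ?r \<omega>) \<le> (\<integral>\<omega>. (\<bar>f \<omega>\<bar> * (W v \<omega>)\<^sup>2) * (t\<^sup>2 / 2) \<partial>M)"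
  proof (rule order_trans[OF integral_norm_bound integral_mono])
    show "integrable M (\<lambda>\<omega>. norm (?r \<omega>))" using i1 i2 i3 by (intro integrable_norm Bochner_Integration.integrable_diff integrable_mult_right)
    have "integrable M (\<lambda>\<omega>. f \<omega> * (W v \<omega>)\<^sup>2)" by (intro all_moments_integrable am)
    then have "integrable M (\<lambda>\<omega>. \<bar>f \<omega> * (W v \<omega>)\<^sup>2\<bar>)" by (rule integrable_abs)
    then show "integrable M (\<lambda>\<omega>. (\<bar>f \<omega>\<bar> * (W v \<omega>)\<^sup>2) * (t\<^sup>2 / 2))" by (simp add: abs_mult)
    fix \<omega>
    define x where "x = t * W v \<omega>"
    have "?r \<omega> = complex_of_real (f \<omega>) * iexp (W h \<omega>) * (iexp x - (\<Sum>k\<le>1. (\<i> * x) ^ k / fact k))"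
      by (simp add: x_def algebra_simps exp_add)
    then have "norm (?r \<omega>) = \<bar>f \<omega>\<bar> * cmod (iexp x - (\<Sum>k\<le>1. (\<i> * x) ^ k / fact k))"
      by (simp add: norm_mult)
    also have "\<dots> \<le> \<bar>f \<omega>\<bar> * (\<bar>x\<bar> ^ Suc 1 / fact (Suc 1))"
      by (intro mult_left_mono iexp_approx1) simp
    also have "\<dots> = (\<bar>f \<omega>\<bar> * (W v \<omega>)\<^sup>2) * (t\<^sup>2 / 2)"
    proof -
      have "\<bar>x\<bar> ^ Suc 1 = x\<^sup>2" by (metis Suc_1 power2_abs)
      then show ?thesis by (simp add: x_def power_mult_distrib)
    qed
    finally show "norm (?r \<omega>) \<le> (\<bar>f \<omega>\<bar> * (W v \<omega>)\<^sup>2) * (t\<^sup>2 / 2)" .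
  qed
  moreover have "(\<integral>\<omega>. (\<bar>f \<omega>\<bar> * (W v \<omega>)\<^sup>2) * (t\<^sup>2 / 2) \<partial>M) = (\<integral>\<omega>. \<bar>f \<omega>\<bar> * (W v \<omega>)\<^sup>2 \<partial>M) / 2 * t\<^sup>2"
    by (simp only: integral_mult_left_zero)
  ultimately show "norm (?E t - ?E 0 - t *\<^sub>R ?D) \<le> (\<integral>\<omega>. \<bar>f \<omega>\<bar> * (W v \<omega>)\<^sup>2 \<partial>M) / 2 * t\<^sup>2"
    by (simp only:)
qed

text \<open>\<open>d g\<close> is the derivative of the polynomial \<open>f\<close> in the direction \<open>g\<close>, with \<open>W v\<close> having derivative
  \<open>\<langle>g, v\<rangle>\<close>.  As a random variable need not determine its polynomial, this is a relation.\<close>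

inductive polynomial_with_gradient :: "('a \<Rightarrow> real) \<Rightarrow> ('h \<Rightarrow> 'a \<Rightarrow> real) \<Rightarrow> bool" where
  const: "polynomial_with_gradient (\<lambda>_. c) (\<lambda>_ _. 0)"
| add: "polynomial_with_gradient f d \<Longrightarrow> polynomial_with_gradient f' d' \<Longrightarrow>
    polynomial_with_gradient (\<lambda>\<omega>. f \<omega> + f' \<omega>) (\<lambda>g \<omega>. d g \<omega> + d' g \<omega>)"
| scale: "polynomial_with_gradient f d \<Longrightarrow> polynomial_with_gradient (\<lambda>\<omega>. c * f \<omega>) (\<lambda>g \<omega>. c * d g \<omega>)"
| times: "polynomial_with_gradient f d \<Longrightarrow>
    polynomial_with_gradient (\<lambda>\<omega>. f \<omega> * W v \<omega>) (\<lambda>g \<omega>. d g \<omega> * W v \<omega> + inner g v * f \<omega>)"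

lemma polynomial_all_moments:
  "polynomial_with_gradient f d \<Longrightarrow> all_moments M f \<and> (\<forall>g. all_moments M (d g))"
  by (induction rule: polynomial_with_gradient.induct)
    (auto intro!: all_moments_intros W_all_moments)

text \<open>The factor \<open>exp(\<i> W(h))\<close> makes the induction work: differentiating the identity for \<open>f\<close> at \<open>h\<close> in
  the direction \<open>v\<close> gives the identity for \<open>f W(v)\<close>.\<close>

lemma integration_by_parts_iexp:
  assumes "polynomial_with_gradient f d"
  shows "(CLINT \<omega>|M. complex_of_real (W g \<omega> * f \<omega>) * iexp (W h \<omega>)) =
    (CLINT \<omega>|M. complex_of_real (d g \<omega>) * iexp (W h \<omega>))
    + \<i> * of_real (inner g h) * (CLINT \<omega>|M. complex_of_real (f \<omega>) * iexp (W h \<omega>))"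
  using assms
proof (induction arbitrary: g h rule: polynomial_with_gradient.induct)
  case (const c)
  \<comment> \<open>For constants, the Gaussian characteristic function at
    \<open>h + t *\<^sub>R g\<close> is differentiated at 0 in two ways: under the expectation and
    in its closed form.\<close>
  have "((\<lambda>t. complex_of_real (exp (- inner (h + t *\<^sub>R g) (h + t *\<^sub>R g) / 2))) has_vector_derivative
     \<i> * (CLINT \<omega>|M. complex_of_real (W g \<omega>) * iexp (W h \<omega>))) (at 0)"
    using iexp_expectation_has_derivative[of "\<lambda>_. 1" h g] all_moments_const[of 1]
    by (simp add: W_char)
  moreover have "((\<lambda>t. complex_of_real (exp (- inner (h + t *\<^sub>R g) (h + t *\<^sub>R g) / 2))) has_vector_derivative
     complex_of_real (- inner g h * exp (- inner h h / 2))) (at 0)"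
  proof (rule has_vector_derivative_of_real)
    have "((\<lambda>t. exp (- (inner h h + 2 * t * inner g h + t * t * inner g g) / 2)) has_field_derivative
      - inner g h * exp (- inner h h / 2)) (at 0)"
      by (auto intro!: derivative_eq_intros)
    then show "((\<lambda>t. exp (- inner (h + t *\<^sub>R g) (h + t *\<^sub>R g) / 2)) has_field_derivative
      - inner g h * exp (- inner h h / 2)) (at 0)"
      by (simp add: inner_add_left inner_add_right
          inner_commute[of h g] algebra_simps)
  qed
  ultimately have "\<i> * (CLINT \<omega>|M. complex_of_real (W g \<omega>) * iexp (W h \<omega>)) = complex_of_real (- inner g h * exp (- inner h h / 2))"
    by (rule vector_derivative_unique_at)
  then have *: "(CLINT \<omega>|M. complex_of_real (W g \<omega>) * iexp (W h \<omega>)) = \<i> * of_real (inner g h) * exp (- inner h h / 2)"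
    by (simp add: complex_eq_iff)
  have "(CLINT \<omega>|M. complex_of_real (W g \<omega> * c) * iexp (W h \<omega>)) = of_real c * (CLINT \<omega>|M. complex_of_real (W g \<omega>) * iexp (W h \<omega>))"
    by (subst integral_mult_right_zero[symmetric]) (simp add: mult_ac)
  moreover have "(CLINT \<omega>|M. complex_of_real c * iexp (W h \<omega>)) = of_real c * exp (- inner h h / 2)"
    using W_char by simp
  ultimately show ?case using * W_char[of h] by simp
next
  case (add f d f' d')
  note p = polynomial_all_moments[OF add.hyps(1)] polynomial_all_moments[OF add.hyps(2)]
  have i: "integrable M (\<lambda>\<omega>. complex_of_real (q \<omega>) * iexp (W h \<omega>))" if "all_moments M q" for q
    by (intro integrable_iexp_mult that) simp
  have "integrable M (\<lambda>\<omega>. complex_of_real (W g \<omega> * f \<omega>) * iexp (W h \<omega>))"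
    "integrable M (\<lambda>\<omega>. complex_of_real (W g \<omega> * f' \<omega>) * iexp (W h \<omega>))"
    using p by (auto intro!: i all_moments_mult W_all_moments simp del: of_real_mult)
  moreover have "integrable M (\<lambda>\<omega>. complex_of_real (f \<omega>) * iexp (W h \<omega>))"
    "integrable M (\<lambda>\<omega>. complex_of_real (f' \<omega>) * iexp (W h \<omega>))"
    "integrable M (\<lambda>\<omega>. complex_of_real (d g \<omega>) * iexp (W h \<omega>))"
    "integrable M (\<lambda>\<omega>. complex_of_real (d' g \<omega>) * iexp (W h \<omega>))"
    using p by (auto intro!: i)
  ultimately show ?case
    using add.IH[of g h] by (simp add: distrib_left distrib_right)
next
  case (scale f d c)
  have "(CLINT \<omega>|M. complex_of_real (W g \<omega> * (c * f \<omega>)) * iexp (W h \<omega>)) = of_real c * (CLINT \<omega>|M. complex_of_real (W g \<omega> * f \<omega>) * iexp (W h \<omega>))"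
    by (subst integral_mult_right_zero[symmetric]) (simp add: mult_ac)
  moreover have "(CLINT \<omega>|M. complex_of_real (c * q \<omega>) * iexp (W h \<omega>)) = of_real c * (CLINT \<omega>|M. complex_of_real (q \<omega>) * iexp (W h \<omega>))" for q
    by (subst integral_mult_right_zero[symmetric]) (simp add: mult_ac)
  ultimately show ?case unfolding scale.IH[of g h] by (simp add: algebra_simps)
next
  case (times f d v)
  note p = polynomial_all_moments[OF times.hyps]
  note der = iexp_expectation_has_derivative[of _ h v]
  let ?E = "\<lambda>q. CLINT \<omega>|M. complex_of_real (q \<omega>) * iexp (W h \<omega>)"
  have i: "integrable M (\<lambda>\<omega>. complex_of_real (q \<omega>) * iexp (W h \<omega>))" if "all_moments M q" for q
    by (intro integrable_iexp_mult that) simp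
  have "((\<lambda>t. CLINT \<omega>|M. complex_of_real (W g \<omega> * f \<omega>) * iexp (W (h + t *\<^sub>R v) \<omega>)) has_vector_derivative
     \<i> * ?E (\<lambda>\<omega>. W g \<omega> * f \<omega> * W v \<omega>)) (at 0)"
    using p by (intro der all_moments_intros W_all_moments) auto
  then have L: "((\<lambda>t. (CLINT \<omega>|M. complex_of_real (d g \<omega>) * iexp (W (h + t *\<^sub>R v) \<omega>))
    + \<i> * of_real (inner g (h + t *\<^sub>R v)) * (CLINT \<omega>|M. complex_of_real (f \<omega>) * iexp (W (h + t *\<^sub>R v) \<omega>))) has_vector_derivative
     \<i> * ?E (\<lambda>\<omega>. W g \<omega> * f \<omega> * W v \<omega>)) (at 0)"
    unfolding times.IH .
  \<comment> \<open>The prefactor depends on \<open>t\<close> too; its derivative produces the new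
    term \<open>inner g v * f\<close> of the gradient.\<close>
  have lin: "((\<lambda>t. \<i> * of_real (inner g (h + t *\<^sub>R v))) has_vector_derivative \<i> * of_real (inner g v)) (at 0)"
    unfolding inner_add_right inner_scaleR_right
    by (intro has_vector_derivative_mult_right has_vector_derivative_of_real)
      (auto intro!: derivative_eq_intros simp: has_real_derivative_iff_has_vector_derivative[symmetric])
  have "((\<lambda>t. (CLINT \<omega>|M. complex_of_real (d g \<omega>) * iexp (W (h + t *\<^sub>R v) \<omega>))
    + \<i> * of_real (inner g (h + t *\<^sub>R v)) * (CLINT \<omega>|M. complex_of_real (f \<omega>) * iexp (W (h + t *\<^sub>R v) \<omega>))) has_vector_derivative
     \<i> * ?E (\<lambda>\<omega>. d g \<omega> * W v \<omega>) + (\<i> * of_real (inner g (h + 0 *\<^sub>R v)) * (\<i> * ?E (\<lambda>\<omega>. f \<omega> * W v \<omega>))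
       + \<i> * of_real (inner g v) * (CLINT \<omega>|M. complex_of_real (f \<omega>) * iexp (W (h + 0 *\<^sub>R v) \<omega>)))) (at 0)"
    using p by (intro has_vector_derivative_add has_vector_derivative_mult lin der) auto
  from vector_derivative_unique_at[OF L this]
  have "\<i> * ?E (\<lambda>\<omega>. W g \<omega> * f \<omega> * W v \<omega>) = \<i> * (?E (\<lambda>\<omega>. d g \<omega> * W v \<omega>)
      + of_real (inner g v) * ?E f + \<i> * of_real (inner g h) * ?E (\<lambda>\<omega>. f \<omega> * W v \<omega>))"
    by (simp add: algebra_simps)
  then have "?E (\<lambda>\<omega>. W g \<omega> * f \<omega> * W v \<omega>) = ?E (\<lambda>\<omega>. d g \<omega> * W v \<omega>)
      + of_real (inner g v) * ?E f + \<i> * of_real (inner g h) * ?E (\<lambda>\<omega>. f \<omega> * W v \<omega>)"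
    by (simp only: mult_left_cancel complex_i_not_zero simp_thms)
  moreover have "?E (\<lambda>\<omega>. d g \<omega> * W v \<omega> + inner g v * f \<omega>) = ?E (\<lambda>\<omega>. d g \<omega> * W v \<omega>) + of_real (inner g v) * ?E f"
  proof -
    have "integrable M (\<lambda>\<omega>. complex_of_real (d g \<omega> * W v \<omega>) * iexp (W h \<omega>))" "integrable M (\<lambda>\<omega>. complex_of_real (f \<omega>) * iexp (W h \<omega>))"
      using p by (auto intro!: i all_moments_mult W_all_moments simp del: of_real_mult)
    then show ?thesis by (simp add: distrib_right mult.assoc)
  qed
  ultimately show ?case by (simp add: mult.assoc)
qed

lemma integration_by_parts:
  assumes "polynomial_with_gradient f d"
  shows "expectation (\<lambda>\<omega>. W g \<omega> * f \<omega>) = expectation (d g)"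
proof -
  \<comment> \<open>With these arguments linearity reads W 0 = W 0 + W 0. Hence at
    \<open>h = 0\<close> the exponential factor is 1 and the term with \<open>inner g h\<close>
    disappears.\<close>
  have W0: "AE \<omega> in M. W 0 \<omega> = 0"
    using W_linear[of 0 1 0] by eventually_elim simp
  have m: "f \<in> borel_measurable M" "d g \<in> borel_measurable M"
    using polynomial_all_moments[OF assms] by (auto intro: all_moments_measurable)
  have *: "(CLINT \<omega>|M. complex_of_real (q \<omega>) * iexp (W 0 \<omega>)) = of_real (expectation q)"
    if [measurable]: "q \<in> borel_measurable M" for q
  proof -
    have "(CLINT \<omega>|M. complex_of_real (q \<omega>) * iexp (W 0 \<omega>)) = (CLINT \<omega>|M. complex_of_real (q \<omega>))"
      by (rule integral_cong_AE) (use W0 in \<open>auto elim!: eventually_mono\<close>)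
    then show ?thesis by simp
  qed
  show ?thesis
    using integration_by_parts_iexp[OF assms, of g 0] m
      *[of "\<lambda>\<omega>. W g \<omega> * f \<omega>"] *[of "d g"] *[of f]
    by (simp del: of_real_mult)
qed

end

section \<open>Cumulants of quadratic forms in Gaussian variables\<close>

context gaussian_process
begin

lemma polynomial_with_gradient_sum:
  assumes "\<And>i. i < n \<Longrightarrow> polynomial_with_gradient (f i) (d i)"
  shows "polynomial_with_gradient (\<lambda>\<omega>. \<Sum>i<(n::nat). f i \<omega>) (\<lambda>g \<omega>. \<Sum>i<n. d i g \<omega>)"
  using assms
proof (induction n)
  case 0
  then show ?case using polynomial_with_gradient.const[of 0] by simp
next
  case (Suc n)
  then show ?case using polynomial_with_gradient.add[of _ _ "f n" "d n"] by simp
qed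

end

locale gaussian_quadratic = gaussian_process M W for M :: "'a measure" and W :: "'h::real_inner \<Rightarrow> 'a \<Rightarrow> real" +
  fixes n :: nat and c :: "nat \<Rightarrow> real" and h :: "nat \<Rightarrow> 'h"
begin

definition quad :: "'a \<Rightarrow> real" where
  "quad \<omega> = (\<Sum>k<n. c k * ((W (h k) \<omega>)\<^sup>2 - (norm (h k))\<^sup>2))"

definition grad :: "'h \<Rightarrow> 'a \<Rightarrow> real" where
  "grad g \<omega> = (\<Sum>k<n. 2 * c k * inner g (h k) * W (h k) \<omega>)"

definition gram :: "real mat" where
  "gram = mat n n (\<lambda>(a, b). c a * inner (h a) (h b))"

text \<open>Product rule for a quadratic factor. The relation multiplies by one \<open>W v\<close>
  at a time, so every square in \<open>quad\<close> is built by two such multiplications.\<close>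

lemma polynomial_mult_quad:
  assumes p: "polynomial_with_gradient f d"
  shows "polynomial_with_gradient (\<lambda>\<omega>. quad \<omega> * f \<omega>) (\<lambda>g \<omega>. quad \<omega> * d g \<omega> + grad g \<omega> * f \<omega>)"
proof -
  note r = polynomial_with_gradient.intros
  have "polynomial_with_gradient
    (\<lambda>\<omega>. \<Sum>k<n. c k * ((f \<omega> * W (h k) \<omega>) * W (h k) \<omega> + (- (norm (h k))\<^sup>2) * f \<omega>))
    (\<lambda>g \<omega>. \<Sum>k<n. c k * (((d g \<omega> * W (h k) \<omega> + inner g (h k) * f \<omega>) * W (h k) \<omega> + inner g (h k) * (f \<omega> * W (h k) \<omega>))
       + (- (norm (h k))\<^sup>2) * d g \<omega>))"
    by (intro polynomial_with_gradient_sum r(2,3,4) p)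
  moreover have "(\<lambda>\<omega>. \<Sum>k<n. c k * ((f \<omega> * W (h k) \<omega>) * W (h k) \<omega> + (- (norm (h k))\<^sup>2) * f \<omega>)) = (\<lambda>\<omega>. quad \<omega> * f \<omega>)"
    unfolding quad_def sum_distrib_right
    by (intro ext sum.cong) (auto simp: algebra_simps power2_eq_square)
  moreover have "(\<lambda>g \<omega>. \<Sum>k<n. c k * (((d g \<omega> * W (h k) \<omega> + inner g (h k) * f \<omega>) * W (h k) \<omega> + inner g (h k) * (f \<omega> * W (h k) \<omega>))
       + (- (norm (h k))\<^sup>2) * d g \<omega>)) = (\<lambda>g \<omega>. quad \<omega> * d g \<omega> + grad g \<omega> * f \<omega>)"
    unfolding quad_def grad_def sum_distrib_right sum.distrib[symmetric]
    by (intro ext sum.cong) (auto simp: algebra_simps power2_eq_square)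
  ultimately show ?thesis by simp
qed

lemma polynomial_quad_power_times:
  "polynomial_with_gradient (\<lambda>\<omega>. quad \<omega> ^ m * W v \<omega>)
     (\<lambda>g \<omega>. inner g v * quad \<omega> ^ m + real m * grad g \<omega> * quad \<omega> ^ (m - 1) * W v \<omega>)"
proof (induction m)
  case 0
  then show ?case
    using polynomial_with_gradient.times[OF polynomial_with_gradient.const[of 1], of v] by simp
next
  case (Suc m)
  have "(\<lambda>g \<omega>. quad \<omega> * (inner g v * quad \<omega> ^ m + real m * grad g \<omega> * quad \<omega> ^ (m - 1) * W v \<omega>) + grad g \<omega> * (quad \<omega> ^ m * W v \<omega>))
     = (\<lambda>g \<omega>. inner g v * quad \<omega> ^ Suc m + real (Suc m) * grad g \<omega> * quad \<omega> ^ (Suc m - 1) * W v \<omega>)"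
    by (intro ext, cases m) (auto simp: algebra_simps)
  moreover have "(\<lambda>\<omega>. quad \<omega> * (quad \<omega> ^ m * W v \<omega>)) = (\<lambda>\<omega>. quad \<omega> ^ Suc m * W v \<omega>)"
    by (simp add: mult.assoc)
  ultimately show ?case using polynomial_mult_quad[OF Suc] by simp
qed

lemma all_moments_quad: "all_moments M quad"
  using polynomial_all_moments[OF polynomial_mult_quad[OF polynomial_with_gradient.const[of 1]]] by simp

lemma all_moments_quad_times: "all_moments M (\<lambda>\<omega>. W u \<omega> * W v \<omega> * quad \<omega> ^ m)"
  by (intro all_moments_intros W_all_moments all_moments_quad)

definition pair_moment :: "nat \<Rightarrow> nat \<Rightarrow> nat \<Rightarrow> real" where
  "pair_moment m i j = expectation (\<lambda>\<omega>. W (h i) \<omega> * W (h j) \<omega> * quad \<omega> ^ m)"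

text \<open>Integration by parts in the factor \<open>W (h i)\<close>. The derivative hits either
  \<open>W (h j)\<close>, giving an inner product, or one of the \<open>m\<close> factors
  \<open>quad\<close>, whose gradient is linear in the \<open>W (h k)\<close>. For
  \<open>m = 0\<close> the truncated exponent \<open>m - 1\<close> is multiplied by 0.\<close>

lemma pair_moment_rec:
  "pair_moment m i j = inner (h i) (h j) * moment M quad m
     + 2 * real m * (\<Sum>k<n. c k * inner (h i) (h k) * pair_moment (m - 1) k j)"
proof -
  have "pair_moment m i j = expectation (\<lambda>\<omega>. W (h i) \<omega> * (quad \<omega> ^ m * W (h j) \<omega>))"
    by (simp add: pair_moment_def mult_ac)
  also have "\<dots> = expectation (\<lambda>\<omega>. inner (h i) (h j) * quad \<omega> ^ m + real m * grad (h i) \<omega> * quad \<omega> ^ (m - 1) * W (h j) \<omega>)"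
    by (rule integration_by_parts[OF polynomial_quad_power_times])
  also have "\<dots> = expectation (\<lambda>\<omega>. inner (h i) (h j) * quad \<omega> ^ m
       + (\<Sum>k<n. 2 * real m * (c k * inner (h i) (h k)) * (W (h k) \<omega> * W (h j) \<omega> * quad \<omega> ^ (m - 1))))"
    by (intro Bochner_Integration.integral_cong)
      (auto simp: grad_def sum_distrib_left sum_distrib_right mult_ac intro!: sum.cong)
  also have "\<dots> = inner (h i) (h j) * moment M quad m
     + (\<Sum>k<n. 2 * real m * (c k * inner (h i) (h k)) * pair_moment (m - 1) k j)"
    using all_moments_integrable[OF all_moments_quad_times]
      all_moments_integrable[OF all_moments_power[OF all_moments_quad]]
    by (simp add: pair_moment_def moment_def)
  finally show ?thesis by (simp add: sum_distrib_left mult_ac)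
qed

text \<open>\<open>E[\<eta>\<^sup>T (D G)\<^sup>q D \<eta> Q\<^sup>m]\<close> for \<open>\<eta> = (W(h\<^sub>k))\<^sub>k\<close>, \<open>D = diag(c)\<close> and the Gram matrix \<open>G\<close> of the \<open>h\<^sub>k\<close>;
  the definition \<open>gram\<close> is \<open>D G\<close>.\<close>

definition weighted_moment :: "nat \<Rightarrow> nat \<Rightarrow> real" where
  "weighted_moment q m = (\<Sum>i<n. \<Sum>j<n. (gram ^\<^sub>m q) $$ (i, j) * c j * pair_moment m i j)"

lemma gram_carrier [simp]: "gram \<in> carrier_mat n n"
  by (simp add: gram_def)

lemma gram_index [simp]: "a < n \<Longrightarrow> b < n \<Longrightarrow> gram $$ (a, b) = c a * inner (h a) (h b)"
  by (simp add: gram_def)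

lemma gram_pow_carrier [simp]: "gram ^\<^sub>m q \<in> carrier_mat n n"
  by simp

lemma gram_pow_Suc_index:
  assumes "i < n" "j < n"
  shows "(gram ^\<^sub>m Suc q) $$ (i, j) = (\<Sum>l<n. (gram ^\<^sub>m q) $$ (i, l) * (c l * inner (h l) (h j)))"
proof -
  have "dim_row gram = n" "dim_col gram = n" "dim_row (gram ^\<^sub>m q) = n" "dim_col (gram ^\<^sub>m q) = n"
    using gram_carrier gram_pow_carrier[of q] by (auto simp del: gram_carrier)
  then show ?thesis using assms
    by (auto simp: scalar_prod_def lessThan_atLeast0 intro!: sum.cong)
qed

text \<open>\<open>pow_mat\<close> appends factors on the right, whereas
  \<open>weighted_moment_rec\<close> also produces one on the left.\<close>

lemma gram_pow_Suc_index':
  assumes "i < n" "j < n"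
  shows "(gram ^\<^sub>m Suc q) $$ (i, j) = (\<Sum>l<n. (c i * inner (h i) (h l)) * (gram ^\<^sub>m q) $$ (l, j))"
proof -
  have "gram ^\<^sub>m Suc q = gram * gram ^\<^sub>m q"
  proof (induction q)
    case 0
    have "dim_row gram = n" using gram_carrier by (simp only: carrier_matD)
    then show ?case using left_mult_one_mat[OF gram_carrier] right_mult_one_mat[OF gram_carrier] by simp
  next
    case (Suc q)
    have "gram ^\<^sub>m Suc (Suc q) = (gram * gram ^\<^sub>m q) * gram" using Suc by simp
    also have "\<dots> = gram * (gram ^\<^sub>m q * gram)"
      by (rule assoc_mult_mat[of _ n n _ n _ n]) auto
    finally show ?case by simp
  qed
  moreover have "dim_row gram = n" "dim_col gram = n" "dim_row (gram ^\<^sub>m q) = n" "dim_col (gram ^\<^sub>m q) = n"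
    using gram_carrier gram_pow_carrier[of q] by (auto simp del: gram_carrier)
  ultimately show ?thesis using assms
    by (auto simp: scalar_prod_def lessThan_atLeast0 simp del: pow_mat.simps intro!: sum.cong)
qed

lemma mtrace_gram_pow: "mtrace (gram ^\<^sub>m q) = (\<Sum>i<n. (gram ^\<^sub>m q) $$ (i, i))"
  using gram_pow_carrier[of q] by (simp only: mtrace_def carrier_matD)

text \<open>Insert \<open>pair_moment_rec\<close>. Summed against the weights, its first term closes
  up to a trace. In its second term the sum over \<open>i\<close> is a matrix product that puts one
  more factor \<open>gram\<close> in front, which leaves the weights of order \<open>Suc q\<close>
  for the pair \<open>k\<close>, \<open>j\<close>.\<close>

lemma weighted_moment_rec:
  "weighted_moment q m = mtrace (gram ^\<^sub>m Suc q) * moment M quad m + 2 * real m * weighted_moment (Suc q) (m - 1)"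
proof -
  let ?A = "gram ^\<^sub>m q"
  have swap3: "(\<Sum>i<n. \<Sum>j<n. \<Sum>k<n. f i j k) = (\<Sum>k<n. \<Sum>j<n. \<Sum>i<n. f i j k)" for f :: "nat \<Rightarrow> nat \<Rightarrow> nat \<Rightarrow> real"
  proof -
    have "(\<Sum>i<n. \<Sum>j<n. \<Sum>k<n. f i j k) = (\<Sum>j<n. \<Sum>i<n. \<Sum>k<n. f i j k)" by (rule sum.swap)
    also have "\<dots> = (\<Sum>j<n. \<Sum>k<n. \<Sum>i<n. f i j k)" by (intro sum.cong refl sum.swap)
    also have "\<dots> = (\<Sum>k<n. \<Sum>j<n. \<Sum>i<n. f i j k)" by (rule sum.swap)
    finally show ?thesis .
  qed
  have "weighted_moment q m = (\<Sum>i<n. \<Sum>j<n. ?A $$ (i, j) * (c j * inner (h j) (h i)) * moment M quad m)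
     + (\<Sum>i<n. \<Sum>j<n. \<Sum>k<n. 2 * real m * ((c k * inner (h k) (h i)) * ?A $$ (i, j) * c j * pair_moment (m - 1) k j))"
    unfolding weighted_moment_def sum.distrib[symmetric]
  proof (intro sum.cong refl)
    fix i j
    have alg: "a * x * (g * u + 2 * y * s) = a * (x * g) * u + (2 * y * a * x) * s" for a x g u y s :: real
      by (simp add: algebra_simps)
    have "?A $$ (i, j) * c j * pair_moment m i j = ?A $$ (i, j) * (c j * inner (h i) (h j)) * moment M quad m
       + (2 * real m * ?A $$ (i, j) * c j) * (\<Sum>k<n. c k * inner (h i) (h k) * pair_moment (m - 1) k j)"
      unfolding pair_moment_rec[of m i j] by (rule alg)
    also have "(2 * real m * ?A $$ (i, j) * c j) * (\<Sum>k<n. c k * inner (h i) (h k) * pair_moment (m - 1) k j)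
      = (\<Sum>k<n. 2 * real m * ((c k * inner (h k) (h i)) * ?A $$ (i, j) * c j * pair_moment (m - 1) k j))"
      unfolding sum_distrib_left by (intro sum.cong refl) (simp only: inner_commute[of "h i"] mult_ac)
    finally show "?A $$ (i, j) * c j * pair_moment m i j = ?A $$ (i, j) * (c j * inner (h j) (h i)) * moment M quad m
       + (\<Sum>k<n. 2 * real m * ((c k * inner (h k) (h i)) * ?A $$ (i, j) * c j * pair_moment (m - 1) k j))"
      by (simp only: inner_commute[of "h j" "h i"])
  qed
  also have "(\<Sum>i<n. \<Sum>j<n. ?A $$ (i, j) * (c j * inner (h j) (h i)) * moment M quad m) = mtrace (gram ^\<^sub>m Suc q) * moment M quad m"
    unfolding mtrace_gram_pow sum_distrib_right[symmetric]
    by (simp add: gram_pow_Suc_index del: pow_mat.simps)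
  also have "(\<Sum>i<n. \<Sum>j<n. \<Sum>k<n. 2 * real m * ((c k * inner (h k) (h i)) * ?A $$ (i, j) * c j * pair_moment (m - 1) k j))
      = (\<Sum>k<n. \<Sum>j<n. \<Sum>i<n. 2 * real m * ((c k * inner (h k) (h i)) * ?A $$ (i, j) * c j * pair_moment (m - 1) k j))"
    by (rule swap3)
  also have "\<dots> = 2 * real m * weighted_moment (Suc q) (m - 1)"
    unfolding weighted_moment_def sum_distrib_left
    by (intro sum.cong refl)
      (simp add: gram_pow_Suc_index' sum_distrib_left sum_distrib_right mult_ac del: pow_mat.simps)
  finally show ?thesis .
qed

text \<open>Each use of the recursion trades a power of \<open>quad\<close> for a power of
  \<open>gram\<close> and contributes a factor 2 and the current exponent of \<open>quad\<close>;
  these exponents multiply to a falling factorial.\<close>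

lemma weighted_moment_eq:
  "weighted_moment q m = (\<Sum>i\<le>m. 2 ^ i * (fact m / fact (m - i)) * mtrace (gram ^\<^sub>m (q + i + 1)) * moment M quad (m - i))"
proof (induction m arbitrary: q)
  case 0
  then show ?case by (subst weighted_moment_rec) simp
next
  case (Suc m)
  show ?case
    unfolding weighted_moment_rec[of q "Suc m"] diff_Suc_1 Suc[of "Suc q"]
    by (simp add: sum.atMost_Suc_shift sum_distrib_left del: sum.atMost_Suc pow_mat.simps)
      (intro sum.cong, auto simp del: pow_mat.simps)
qed

text \<open>At \<open>k = 1\<close> the general formula would give the trace of \<open>gram\<close>,
  which the centring of \<open>quad\<close> removes. The value at 0 is a mere default.\<close>

definition quad_cumulant :: "nat \<Rightarrow> real" where
  "quad_cumulant k = (if k \<le> 1 then 0 else 2 ^ (k - 1) * fact (k - 1) * mtrace (gram ^\<^sub>m k))"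

lemma quad_alt: "quad \<omega> = (\<Sum>i<n. c i * (W (h i) \<omega> * W (h i) \<omega>)) - (\<Sum>i<n. c i * inner (h i) (h i))"
  unfolding quad_def sum_subtractf[symmetric]
  by (intro sum.cong) (auto simp: right_diff_distrib power2_eq_square[of "W _ _"] power2_norm_eq_inner)

text \<open>Splitting off one factor \<open>quad\<close> leaves \<open>weighted_moment 0 m\<close>
  minus a trace times the \<open>m\<close>-th moment. In the unrolled form of
  \<open>weighted_moment_eq\<close> the term of index 0 cancels against this trace, and in the
  others the falling factorial is a binomial coefficient times the factorial in the
  cumulant.\<close>

lemma quad_moment_cumulant_rec: "moment_cumulant_rec (moment M quad) quad_cumulant"
  unfolding moment_cumulant_rec_def
proof (intro conjI allI)
  show "moment M quad 0 = 1" by (simp add: moment_def prob_space)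
  fix m
  have "moment M quad (Suc m) = expectation (\<lambda>\<omega>. (\<Sum>i<n. c i * (W (h i) \<omega> * W (h i) \<omega> * quad \<omega> ^ m))
      - (\<Sum>i<n. c i * inner (h i) (h i)) * quad \<omega> ^ m)"
    unfolding moment_def
  proof (intro Bochner_Integration.integral_cong refl)
    fix \<omega>
    show "quad \<omega> ^ Suc m = (\<Sum>i<n. c i * (W (h i) \<omega> * W (h i) \<omega> * quad \<omega> ^ m)) - (\<Sum>i<n. c i * inner (h i) (h i)) * quad \<omega> ^ m"
      using arg_cong[OF quad_alt[of \<omega>], of "\<lambda>x. x * quad \<omega> ^ m"]
      by (simp only: power_Suc left_diff_distrib sum_distrib_right mult.assoc)
  qed
  also have "\<dots> = (\<Sum>i<n. c i * pair_moment m i i) - (\<Sum>i<n. c i * inner (h i) (h i)) * moment M quad m"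
    using all_moments_integrable[OF all_moments_quad_times]
      all_moments_integrable[OF all_moments_power[OF all_moments_quad]]
    by (simp add: pair_moment_def moment_def)
  also have "(\<Sum>i<n. c i * pair_moment m i i) = weighted_moment 0 m"
    unfolding weighted_moment_def
  proof (rule sum.cong[OF refl])
    fix i assume i: "i \<in> {..<n}"
    have "dim_row gram = n" using gram_carrier by (simp only: carrier_matD)
    then have "(\<Sum>j<n. (gram ^\<^sub>m 0) $$ (i, j) * c j * pair_moment m i j) = (\<Sum>j<n. if i = j then c j * pair_moment m i j else 0)"
      using i by (intro sum.cong refl) simp
    then show "c i * pair_moment m i i = (\<Sum>j<n. (gram ^\<^sub>m 0) $$ (i, j) * c j * pair_moment m i j)"
      using i by simp
  qed
  also have "(\<Sum>i<n. c i * inner (h i) (h i)) = mtrace (gram ^\<^sub>m Suc 0)"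
  proof -
    have "gram ^\<^sub>m Suc 0 = gram"
      using left_mult_one_mat[OF gram_carrier] gram_carrier by (metis carrier_matD(1) pow_mat.simps)
    then show ?thesis unfolding mtrace_gram_pow by simp
  qed
  also have "weighted_moment 0 m = mtrace (gram ^\<^sub>m Suc 0) * moment M quad m
      + (\<Sum>i<m. 2 ^ Suc i * (fact m / fact (m - Suc i)) * mtrace (gram ^\<^sub>m Suc (Suc i)) * moment M quad (m - Suc i))"
    unfolding weighted_moment_eq sum.atMost_shift by (simp del: pow_mat.simps power_Suc)
  also have "(\<Sum>i<m. 2 ^ Suc i * (fact m / fact (m - Suc i)) * mtrace (gram ^\<^sub>m Suc (Suc i)) * moment M quad (m - Suc i))
      = (\<Sum>i<m. of_nat (m choose Suc i) * quad_cumulant (Suc (Suc i)) * moment M quad (m - Suc i))"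
  proof (intro sum.cong refl)
    fix i assume "i \<in> {..<m}"
    then have A: "real (m choose Suc i) * fact (Suc i) = fact m / fact (m - Suc i)"
      by (subst binomial_fact) (auto simp del: fact_Suc)
    have B: "quad_cumulant (Suc (Suc i)) = 2 ^ Suc i * fact (Suc i) * mtrace (gram ^\<^sub>m Suc (Suc i))"
      by (simp add: quad_cumulant_def del: pow_mat.simps fact_Suc power_Suc)
    show "2 ^ Suc i * (fact m / fact (m - Suc i)) * mtrace (gram ^\<^sub>m Suc (Suc i)) * moment M quad (m - Suc i)
      = of_nat (m choose Suc i) * quad_cumulant (Suc (Suc i)) * moment M quad (m - Suc i)"
      unfolding A[symmetric] B by (simp only: mult_ac)
  qed
  also have "mtrace (gram ^\<^sub>m Suc 0) * moment M quad m + (\<Sum>i<m. of_nat (m choose Suc i) * quad_cumulant (Suc (Suc i)) * moment M quad (m - Suc i))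
       - mtrace (gram ^\<^sub>m Suc 0) * moment M quad m
      = (\<Sum>i\<le>m. of_nat (m choose i) * quad_cumulant (Suc i) * moment M quad (m - i))"
    unfolding sum.atMost_shift by (simp add: quad_cumulant_def[of "Suc 0"] del: pow_mat.simps)
  finally show "moment M quad (Suc m) = (\<Sum>i\<le>m. of_nat (m choose i) * quad_cumulant (Suc i) * moment M quad (m - i))" .
qed

lemma quad_cumulant_eigenvalues:
  "\<exists>e :: nat \<Rightarrow> real. \<forall>k\<ge>2. quad_cumulant k = 2 ^ (k - 1) * fact (k - 1) * (\<Sum>i<n. e i ^ k)"
proof -
  obtain e where "\<And>k. mtrace (gram ^\<^sub>m k) = (\<Sum>i<n. e i ^ k)"
    using mtrace_pow_diag_gram[of n c h] unfolding gram_def by blast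
  then show ?thesis by (intro exI[of _ e]) (simp add: quad_cumulant_def)
qed

end

section \<open>Limits in mean square\<close>

lemma abs_power_diff_le:
  fixes x y :: real
  shows "\<bar>x ^ n - y ^ n\<bar> \<le> real n * (\<bar>x - y\<bar> * (\<bar>x\<bar> + \<bar>y\<bar>) ^ (n - 1))"
proof -
  have "\<bar>\<Sum>i<n. y ^ (n - Suc i) * x ^ i\<bar> \<le> (\<Sum>i<n. \<bar>y ^ (n - Suc i) * x ^ i\<bar>)" by (rule sum_abs)
  also have "\<dots> \<le> (\<Sum>i<n. (\<bar>x\<bar> + \<bar>y\<bar>) ^ (n - 1))"
  proof (rule sum_mono)
    fix i assume i: "i \<in> {..<n}"
    have "\<bar>y ^ (n - Suc i) * x ^ i\<bar> = \<bar>y\<bar> ^ (n - Suc i) * \<bar>x\<bar> ^ i" by (simp add: abs_mult power_abs)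
    also have "\<dots> \<le> (\<bar>x\<bar> + \<bar>y\<bar>) ^ (n - Suc i) * (\<bar>x\<bar> + \<bar>y\<bar>) ^ i"
      by (intro mult_mono power_mono) auto
    also have "\<dots> = (\<bar>x\<bar> + \<bar>y\<bar>) ^ (n - 1)" using i by (simp flip: power_add)
    finally show "\<bar>y ^ (n - Suc i) * x ^ i\<bar> \<le> (\<bar>x\<bar> + \<bar>y\<bar>) ^ (n - 1)" .
  qed
  finally have "\<bar>x - y\<bar> * \<bar>\<Sum>i<n. y ^ (n - Suc i) * x ^ i\<bar> \<le> \<bar>x - y\<bar> * (real n * (\<bar>x\<bar> + \<bar>y\<bar>) ^ (n - 1))"
    by (intro mult_left_mono) auto
  then show ?thesis unfolding power_diff_sumr2 abs_mult by (simp add: mult_ac)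
qed

text \<open>Almost sure convergence along a subsequence and Fatou's lemma carry the bounds
  \<open>B k\<close> over to \<open>F\<close>. The difference of k-th powers is then estimated by |F
  - Q| times a power of |F| + |Q|, and the product is split into squares with a weight that tends to
  0 slowly enough.\<close>

lemma (in prob_space) L2_limit_moments:
  fixes Q :: "nat \<Rightarrow> 'a \<Rightarrow> real" and F :: "'a \<Rightarrow> real"
  assumes Q: "\<And>j. all_moments M (Q j)" and F [measurable]: "F \<in> borel_measurable M"
    and F2: "integrable M (\<lambda>x. (F x)\<^sup>2)"
    and lim: "(\<lambda>j. expectation (\<lambda>x. (F x - Q j x)\<^sup>2)) \<longlonglongrightarrow> 0"
    and bound: "\<And>j k. moment M (Q j) (2 * k) \<le> B k"
  shows "all_moments M F" and "(\<lambda>j. moment M (Q j) k) \<longlonglongrightarrow> moment M F k"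
proof -
  have [measurable]: "Q j \<in> borel_measurable M" for j using Q by (rule all_moments_measurable)
  have iQ: "integrable M (\<lambda>x. Q j x ^ k)" for j k
    by (intro all_moments_integrable all_moments_power Q)
  have iD: "integrable M (\<lambda>x. (F x - Q j x)\<^sup>2)" for j
  proof (rule Bochner_Integration.integrable_bound)
    show "integrable M (\<lambda>x. 2 * (F x)\<^sup>2 + 2 * (Q j x)\<^sup>2)" using F2 iQ by simp
    show "AE x in M. norm ((F x - Q j x)\<^sup>2) \<le> norm (2 * (F x)\<^sup>2 + 2 * (Q j x)\<^sup>2)"
    proof (rule AE_I2)
      fix x
      have "0 \<le> (F x + Q j x)\<^sup>2" by simp
      then have "(F x - Q j x)\<^sup>2 \<le> 2 * (F x)\<^sup>2 + 2 * (Q j x)\<^sup>2"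
        by (simp add: power2_eq_square algebra_simps)
      then show "norm ((F x - Q j x)\<^sup>2) \<le> norm (2 * (F x)\<^sup>2 + 2 * (Q j x)\<^sup>2)" by simp
    qed
  qed simp
  have "\<exists>r. strict_mono r \<and> (AE x in M. (\<lambda>j. (F x - Q (r j) x)\<^sup>2) \<longlonglongrightarrow> 0)"
    by (rule tendsto_L1_AE_subseq) (use iD lim in simp_all)
  then obtain r where ae: "AE x in M. (\<lambda>j. (F x - Q (r j) x)\<^sup>2) \<longlonglongrightarrow> 0"
    by blast
  have conv: "AE x in M. (\<lambda>j. Q (r j) x) \<longlonglongrightarrow> F x"
    using ae
  proof eventually_elim
    case (elim x)
    have "(\<lambda>j. F x - Q (r j) x) \<longlonglongrightarrow> 0"
      using tendsto_real_sqrt[OF elim] by (simp add: tendsto_rabs_zero_iff)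
    from tendsto_diff[OF tendsto_const[of "F x"] this] show ?case by simp
  qed
  have B: "0 \<le> B k" for k
    using order_trans[OF _ bound[of 0 k]] by (simp add: moment_def zero_le_even_power)
  have nn: "(\<integral>\<^sup>+x. ennreal (F x ^ (2 * k)) \<partial>M) \<le> ennreal (B k)" for k
  proof -
    have "(\<integral>\<^sup>+x. ennreal (F x ^ (2 * k)) \<partial>M) = (\<integral>\<^sup>+x. liminf (\<lambda>j. ennreal (Q (r j) x ^ (2 * k))) \<partial>M)"
    proof (rule nn_integral_cong_AE)
      show "AE x in M. ennreal (F x ^ (2 * k)) = liminf (\<lambda>j. ennreal (Q (r j) x ^ (2 * k)))"
        using conv
      proof eventually_elim
        case (elim x)
        have "(\<lambda>j. ennreal (Q (r j) x ^ (2 * k))) \<longlonglongrightarrow> ennreal (F x ^ (2 * k))"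
          by (intro tendsto_ennrealI tendsto_power elim)
        from lim_imp_Liminf[OF sequentially_bot this] show ?case by (rule sym)
      qed
    qed
    also have "\<dots> \<le> liminf (\<lambda>j. \<integral>\<^sup>+x. ennreal (Q (r j) x ^ (2 * k)) \<partial>M)"
      by (rule nn_integral_liminf) simp
    also have "\<dots> \<le> liminf (\<lambda>j. ennreal (B k))"
    proof (rule Liminf_mono, rule always_eventually, rule allI)
      fix j
      have "(\<integral>\<^sup>+x. ennreal (Q (r j) x ^ (2 * k)) \<partial>M) = ennreal (moment M (Q (r j)) (2 * k))"
        unfolding moment_def using iQ by (intro nn_integral_eq_integral) (auto simp: zero_le_even_power)
      then show "(\<integral>\<^sup>+x. ennreal (Q (r j) x ^ (2 * k)) \<partial>M) \<le> ennreal (B k)"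
        using bound by (simp add: ennreal_leI)
    qed
    finally show ?thesis by (simp add: Liminf_const)
  qed
  show FM: "all_moments M F"
    unfolding all_moments_def
  proof (intro conjI allI integrableI_nonneg)
    fix k
    show "(\<integral>\<^sup>+x. ennreal (F x ^ (2 * k)) \<partial>M) < \<infinity>"
      using nn[of k] by (simp add: order_le_less_trans)
  qed (auto simp: zero_le_even_power)
  have iF: "integrable M (\<lambda>x. F x ^ k)" for k
    by (intro all_moments_integrable all_moments_power FM)
  have mF: "moment M F (2 * k) \<le> B k" for k
  proof -
    have "ennreal (moment M F (2 * k)) = (\<integral>\<^sup>+x. ennreal (F x ^ (2 * k)) \<partial>M)"
      unfolding moment_def using iF by (intro nn_integral_eq_integral[symmetric]) (auto simp: zero_le_even_power)
    then have "ennreal (moment M F (2 * k)) \<le> ennreal (B k)" using nn[of k] by simp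
    then show ?thesis using B[of k] by (simp only: ennreal_le_iff)
  qed
  define \<delta> where "\<delta> j = expectation (\<lambda>x. (F x - Q j x)\<^sup>2)" for j
  \<comment> \<open>The weight of the splitting: the summand \<open>1 / real (Suc j)\<close> keeps
    it positive even if \<open>\<delta> j = 0\<close>, and the square root makes
    \<open>\<delta> j / s j\<close> at most \<open>s j\<close>.\<close>
  define s where "s j = sqrt (\<delta> j) + 1 / real (Suc j)" for j
  have \<delta>: "0 \<le> \<delta> j" for j unfolding \<delta>_def by simp
  have s_pos: "0 < s j" for j using \<delta>[of j] by (simp add: s_def add_nonneg_pos)
  have \<delta>s: "\<delta> j \<le> (s j)\<^sup>2" for j
  proof -
    have "\<delta> j = (sqrt (\<delta> j))\<^sup>2" using \<delta> by simp
    also have "\<dots> \<le> (s j)\<^sup>2" using \<delta> by (intro power_mono) (auto simp: s_def)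
    finally show ?thesis .
  qed
  have s0: "s \<longlonglongrightarrow> 0"
  proof -
    have "(\<lambda>j. sqrt (\<delta> j) + 1 / real (Suc j)) \<longlonglongrightarrow> sqrt 0 + 0"
      using lim unfolding \<delta>_def by (intro tendsto_add tendsto_real_sqrt LIMSEQ_Suc[OF lim_1_over_n]) auto
    then show ?thesis unfolding s_def by simp
  qed
  define l where "l = k - 1"
  define K where "K = 2 ^ (2 * l) * (B l + B l)"
  define G where "G j x = (\<bar>F x\<bar> + \<bar>Q j x\<bar>) ^ l" for j x
  have G2: "(G j x)\<^sup>2 \<le> 2 ^ (2 * l) * (F x ^ (2 * l) + Q j x ^ (2 * l))" for j x
  proof -
    define m where "m = max \<bar>F x\<bar> \<bar>Q j x\<bar>"
    have "(G j x)\<^sup>2 = (\<bar>F x\<bar> + \<bar>Q j x\<bar>) ^ (2 * l)" by (simp add: G_def power_mult[symmetric] mult.commute)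
    also have "\<dots> \<le> (2 * m) ^ (2 * l)" by (intro power_mono) (auto simp: m_def)
    also have "\<dots> = 2 ^ (2 * l) * m ^ (2 * l)" by (rule power_mult_distrib)
    also have "m ^ (2 * l) \<le> F x ^ (2 * l) + Q j x ^ (2 * l)"
      by (auto simp: m_def max_def power_even_abs zero_le_even_power)
    finally show ?thesis by simp
  qed
  have main: "\<bar>moment M (Q j) k - moment M F k\<bar> \<le> real k * (s j + s j * K)" for j
  proof -
    let ?b = "\<lambda>x. real k * (1 / s j * (F x - Q j x)\<^sup>2 + s j * (2 ^ (2 * l) * (F x ^ (2 * l) + Q j x ^ (2 * l))))"
    have ib: "integrable M ?b"
      using iD iF iQ by simp
    have "\<bar>moment M (Q j) k - moment M F k\<bar> = \<bar>expectation (\<lambda>x. Q j x ^ k - F x ^ k)\<bar>"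
      using iF iQ by (simp add: moment_def)
    also have "\<dots> \<le> expectation (\<lambda>x. \<bar>Q j x ^ k - F x ^ k\<bar>)"
      by (rule integral_abs_bound)
    also have "\<dots> \<le> expectation ?b"
    proof (rule integral_mono)
      show "integrable M (\<lambda>x. \<bar>Q j x ^ k - F x ^ k\<bar>)" using iF iQ by simp
      fix x
      have "\<bar>Q j x ^ k - F x ^ k\<bar> \<le> real k * (\<bar>Q j x - F x\<bar> * (\<bar>Q j x\<bar> + \<bar>F x\<bar>) ^ l)"
        unfolding l_def by (rule abs_power_diff_le)
      also have "\<bar>Q j x - F x\<bar> * (\<bar>Q j x\<bar> + \<bar>F x\<bar>) ^ l = \<bar>F x - Q j x\<bar> * G j x"
        by (simp add: G_def add.commute abs_minus_commute)
      also have "\<bar>F x - Q j x\<bar> * G j x \<le> 1 / s j * (F x - Q j x)\<^sup>2 + s j * (G j x)\<^sup>2"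
      proof -
        have alg: "a * b \<le> 1 / t * a\<^sup>2 + t * b\<^sup>2" if "0 < t" "0 \<le> a" "0 \<le> b" for a b t :: real
        proof -
          have "0 \<le> (a - t * b)\<^sup>2" "0 \<le> a * b * t" using that by simp_all
          then have "a * b * t \<le> a\<^sup>2 + t * t * b\<^sup>2" by (simp add: power2_eq_square algebra_simps)
          then show ?thesis using that(1) by (simp add: field_simps)
        qed
        show ?thesis using alg[OF s_pos[of j], of "\<bar>F x - Q j x\<bar>" "G j x"] by (simp add: G_def)
      qed
      also have "s j * (G j x)\<^sup>2 \<le> s j * (2 ^ (2 * l) * (F x ^ (2 * l) + Q j x ^ (2 * l)))"
        using s_pos[of j] by (intro mult_left_mono G2) simp
      finally show "\<bar>Q j x ^ k - F x ^ k\<bar> \<le> ?b x" by (simp add: mult_left_mono)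
    qed (rule ib)
    also have "expectation ?b = real k * (1 / s j * \<delta> j + s j * (2 ^ (2 * l) * (moment M F (2 * l) + moment M (Q j) (2 * l))))"
      using iD iF iQ by (simp add: \<delta>_def moment_def)
    also have "\<dots> \<le> real k * (1 / s j * (s j)\<^sup>2 + s j * K)"
      unfolding K_def using s_pos[of j] \<delta>s mF bound
      by (intro mult_left_mono add_mono) auto
    also have "\<dots> = real k * (s j + s j * K)"
      using s_pos[of j] by (simp add: power2_eq_square)
    finally show ?thesis .
  qed
  have "(\<lambda>j. real k * (s j + s j * K)) \<longlonglongrightarrow> real k * (0 + 0 * K)"
    by (intro tendsto_intros s0)
  then have "(\<lambda>j. real k * (s j + s j * K)) \<longlonglongrightarrow> 0" by simp
  then have "(\<lambda>j. moment M (Q j) k - moment M F k) \<longlonglongrightarrow> 0"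
    by (rule Lim_null_comparison[rotated]) (use main in simp)
  then show "(\<lambda>j. moment M (Q j) k) \<longlonglongrightarrow> moment M F k"
    by (rule LIM_zero_cancel)
qed

section \<open>Moment generating functions\<close>

text \<open>Growth that makes the exponential series of the variable converge in mean for arguments
  of modulus below \<open>1 / C\<close>. The factor 2 leaves room for the odd absolute moments,
  which are not moments themselves.\<close>

definition factorial_moments :: "'a measure \<Rightarrow> ('a \<Rightarrow> real) \<Rightarrow> real \<Rightarrow> bool" where
  "factorial_moments M X C \<longleftrightarrow> 0 < C \<and> X \<in> borel_measurable M \<and>
     (\<forall>k. integrable M (\<lambda>x. X x ^ k)) \<and> (\<forall>k. (\<integral>x. \<bar>X x\<bar> ^ k \<partial>M) \<le> 2 * (fact k * C ^ k))"

lemma (in prob_space) factorial_momentsI: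
  assumes X: "all_moments M X" and C: "0 < C" and bound: "\<And>k. \<bar>moment M X k\<bar> \<le> fact k * C ^ k"
  shows "factorial_moments M X C"
proof -
  have iX: "integrable M (\<lambda>x. X x ^ k)" for k
    by (intro all_moments_integrable all_moments_power X)
  then have iaX: "integrable M (\<lambda>x. \<bar>X x\<bar> ^ k)" for k
    using integrable_abs[OF iX[of k]] by (simp add: power_abs)
  have even: "(\<integral>x. \<bar>X x\<bar> ^ (2 * l) \<partial>M) \<le> fact (2 * l) * C ^ (2 * l)" for l
    using bound[of "2 * l"] by (simp add: moment_def power_even_abs)
  have "(\<integral>x. \<bar>X x\<bar> ^ k \<partial>M) \<le> 2 * (fact k * C ^ k)" for k
  proof (cases "even k")
    case True
    then obtain l where l: "k = 2 * l" by (elim evenE)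
    have "0 \<le> fact (2 * l) * C ^ (2 * l)" using C by simp
    then show ?thesis using even[of l] unfolding l by linarith
  next
    case False
    then obtain l where l: "k = 2 * l + 1" by (elim oddE)
    \<comment> \<open>An odd absolute moment is interpolated between its even neighbours with weight
      \<open>a\<close>. This choice turns the lower neighbour's bound into
      \<open>fact k * C ^ k\<close>, while the upper one's is (k + 1)/k times that; their mean is at
      most 3/2 of it.\<close>
    define a where "a = real k * C"
    have a: "0 < a" using C l by (simp add: a_def)
    have "(\<integral>x. \<bar>X x\<bar> ^ k \<partial>M) \<le> (\<integral>x. (a * \<bar>X x\<bar> ^ (2 * l) + 1 / a * \<bar>X x\<bar> ^ (2 * (l + 1))) / 2 \<partial>M)"
    proof (rule integral_mono)
      show "integrable M (\<lambda>x. (a * \<bar>X x\<bar> ^ (2 * l) + 1 / a * \<bar>X x\<bar> ^ (2 * (l + 1))) / 2)"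
        by (intro integrable_divide Bochner_Integration.integrable_add integrable_mult_right iaX)
      fix x
      define y where "y = \<bar>X x\<bar>"
      have "0 \<le> (a - y)\<^sup>2 * (1 / a)" using a by simp
      also have "\<dots> = a + y\<^sup>2 / a - 2 * y" using a by (simp add: power2_eq_square field_simps)
      finally have "2 * y \<le> a + y\<^sup>2 / a" by simp
      then have "y ^ (2 * l) * (2 * y) \<le> y ^ (2 * l) * (a + y\<^sup>2 / a)"
        by (rule mult_left_mono) (simp add: y_def)
      then show "\<bar>X x\<bar> ^ k \<le> (a * \<bar>X x\<bar> ^ (2 * l) + 1 / a * \<bar>X x\<bar> ^ (2 * (l + 1))) / 2"
        unfolding l y_def[symmetric] by (simp add: power_add power2_eq_square algebra_simps)
    qed (rule iaX)
    also have "\<dots> = (a * (\<integral>x. \<bar>X x\<bar> ^ (2 * l) \<partial>M) + 1 / a * (\<integral>x. \<bar>X x\<bar> ^ (2 * (l + 1)) \<partial>M)) / 2"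
      by (subst integral_divide_zero, subst Bochner_Integration.integral_add)
        (intro integrable_mult_right iaX, intro integrable_mult_right iaX, simp only: integral_mult_right_zero)
    also have "\<dots> \<le> (a * (fact (2 * l) * C ^ (2 * l)) + 1 / a * (fact (2 * (l + 1)) * C ^ (2 * (l + 1)))) / 2"
      using a by (intro divide_right_mono add_mono mult_left_mono even) auto
    also have "a * (fact (2 * l) * C ^ (2 * l)) = fact k * C ^ k"
      by (simp add: a_def l algebra_simps)
    also have "1 / a * (fact (2 * (l + 1)) * C ^ (2 * (l + 1))) = (real (k + 1) / real k) * (fact k * C ^ k)"
    proof -
      have e: "2 * (l + 1) = Suc k" by (simp add: l)
      have "1 / (y * C) * ((y + 1) * f * (C * c)) = (y + 1) / y * (f * c)" if "0 < y" for y f c :: real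
        using that C by (simp add: divide_simps mult_ac)
      from this[of "real k" "fact k" "C ^ k"] show ?thesis
        unfolding e a_def using l by (simp add: add.commute del: of_nat_mult)
    qed
    also have "\<dots> \<le> 2 * (fact k * C ^ k)"
      using C l by (intro mult_right_mono) (auto simp: field_simps)
    finally have "(\<integral>x. \<bar>X x\<bar> ^ k \<partial>M) \<le> (fact k * C ^ k + 2 * (fact k * C ^ k)) / 2" by simp
    moreover have "0 \<le> fact k * C ^ k" using C by simp
    moreover have "x \<le> 2 * y" if "x \<le> (y + 2 * y) / 2" "0 \<le> y" for x y :: real
      using that by simp
    ultimately show ?thesis by blast
  qed
  then show ?thesis
    using X C iX unfolding factorial_moments_def by (auto intro: all_moments_measurable)
qed

lemma summable_geometric_bound:
  assumes "0 < C" "cmod z < 1 / C"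
  shows "summable (\<lambda>k. 2 * (C * cmod z) ^ k)"
  using assms by (intro summable_mult summable_geometric) (simp add: field_simps)

text \<open>The bounded factor \<open>G\<close> moves the centre of the expansion: with
  \<open>G\<close> the exponential of i t X, it becomes the expansion of the moment generating
  function around i t, with a radius independent of t.\<close>

lemma (in prob_space) exp_expectation_sums:
  fixes G :: "'a \<Rightarrow> complex"
  assumes X: "factorial_moments M X C" and z: "cmod z < 1 / C"
    and G [measurable]: "G \<in> borel_measurable M" and G1: "\<And>x. cmod (G x) \<le> 1"
  shows "(\<lambda>k. (CLINT x|M. G x * complex_of_real (X x ^ k)) / fact k * z ^ k) sums (CLINT x|M. G x * exp (z * complex_of_real (X x)))"
proof -
  have [measurable]: "X \<in> borel_measurable M" and C: "0 < C" and iX: "\<And>k. integrable M (\<lambda>x. X x ^ k)"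
    and bX: "\<And>k. (\<integral>x. \<bar>X x\<bar> ^ k \<partial>M) \<le> 2 * (fact k * C ^ k)"
    using X by (auto simp: factorial_moments_def)
  let ?f = "\<lambda>k x. (G x * complex_of_real (X x ^ k)) * (z ^ k / fact k)"
  have iG: "integrable M (\<lambda>x. G x * complex_of_real (X x ^ k))" for k
  proof (rule Bochner_Integration.integrable_bound[OF iX[of k]])
    show "AE x in M. norm (G x * complex_of_real (X x ^ k)) \<le> norm (X x ^ k)"
      using G1 by (auto simp: norm_mult norm_power power_abs intro!: mult_left_le_one_le)
  qed simp
  have iaX: "integrable M (\<lambda>x. \<bar>X x\<bar> ^ k)" for k
    using integrable_abs[OF iX[of k]] by (simp add: power_abs)
  have pt: "(\<lambda>k. ?f k x) sums (G x * exp (z * complex_of_real (X x)))" for x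
  proof -
    have "(\<lambda>k. G x * ((z * complex_of_real (X x)) ^ k /\<^sub>R fact k)) sums (G x * exp (z * complex_of_real (X x)))"
      by (intro sums_mult exp_converges)
    then show ?thesis by (simp add: power_mult_distrib scaleR_conv_of_real divide_inverse mult_ac)
  qed
  have "(\<lambda>k. integral\<^sup>L M (?f k)) sums (\<integral>x. (\<Sum>k. ?f k x) \<partial>M)"
  proof (rule sums_integral)
    show "integrable M (?f k)" for k by (intro integrable_mult_left iG)
    show "AE x in M. summable (\<lambda>k. norm (?f k x))"
    proof (rule AE_I2)
      fix x
      have "norm (?f k x) = cmod (G x) * ((cmod z * \<bar>X x\<bar>) ^ k /\<^sub>R fact k)" for k
      proof -
        have "norm (?f k x) = cmod (G x) * (\<bar>X x\<bar> ^ k * (cmod z ^ k / fact k))"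
          by (simp add: norm_mult norm_divide norm_power)
        also have "\<bar>X x\<bar> ^ k * (cmod z ^ k / fact k) = (cmod z * \<bar>X x\<bar>) ^ k /\<^sub>R fact k"
          by (simp add: power_mult_distrib divide_inverse)
        finally show ?thesis .
      qed
      then show "summable (\<lambda>k. norm (?f k x))"
        by (simp only: summable_mult summable_exp_generic)
    qed
    show "summable (\<lambda>k. \<integral>x. norm (?f k x) \<partial>M)"
    proof (rule summable_comparison_test'[OF summable_geometric_bound[OF C z]])
      fix k
      have "(\<integral>x. norm (?f k x) \<partial>M) \<le> (\<integral>x. \<bar>X x\<bar> ^ k * (cmod z ^ k / fact k) \<partial>M)"
      proof (rule integral_mono)
        show "integrable M (\<lambda>x. norm (?f k x))" by (intro integrable_norm integrable_mult_left iG)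
        show "integrable M (\<lambda>x. \<bar>X x\<bar> ^ k * (cmod z ^ k / fact k))" by (intro integrable_mult_left iaX)
        fix x
        have "norm (?f k x) = cmod (G x) * (\<bar>X x\<bar> ^ k * (cmod z ^ k / fact k))"
          by (simp add: norm_mult norm_divide norm_power)
        also have "\<dots> \<le> \<bar>X x\<bar> ^ k * (cmod z ^ k / fact k)"
          using G1[of x] by (intro mult_left_le_one_le) auto
        finally show "norm (?f k x) \<le> \<bar>X x\<bar> ^ k * (cmod z ^ k / fact k)" .
      qed
      also have "\<dots> = (\<integral>x. \<bar>X x\<bar> ^ k \<partial>M) * (cmod z ^ k / fact k)" by (rule integral_mult_left_zero)
      also have "\<dots> \<le> 2 * (fact k * C ^ k) * (cmod z ^ k / fact k)"
        by (intro mult_right_mono bX) simp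
      also have "\<dots> = 2 * (C * cmod z) ^ k" by (simp add: power_mult_distrib)
      finally show "norm (\<integral>x. norm (?f k x) \<partial>M) \<le> 2 * (C * cmod z) ^ k"
        by (simp add: integral_nonneg_AE)
    qed
  qed
  also have "(\<integral>x. (\<Sum>k. ?f k x) \<partial>M) = (CLINT x|M. G x * exp (z * complex_of_real (X x)))"
    using sums_unique[OF pt] by simp
  also have "(\<lambda>k. integral\<^sup>L M (?f k)) = (\<lambda>k. (CLINT x|M. G x * complex_of_real (X x ^ k)) / fact k * z ^ k)"
    by (subst integral_mult_left_zero) (simp add: field_simps)
  finally show ?thesis .
qed

section \<open>The complex moment generating function, determinacy by moments, and derivatives of
  its logarithm\<close>

definition cmgf :: "'a measure \<Rightarrow> ('a \<Rightarrow> real) \<Rightarrow> complex \<Rightarrow> complex" where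
  "cmgf M X z = (CLINT x|M. exp (z * complex_of_real (X x)))"

lemma (in prob_space) char_eq_cmgf:
  assumes [measurable]: "X \<in> borel_measurable M"
  shows "char (distr M borel X) t = cmgf M X (\<i> * t)"
  unfolding char_def cmgf_def by (subst integral_distr) (auto simp: mult.assoc)

lemma (in prob_space) cmgf_sums:
  assumes "factorial_moments M X C" "cmod z < 1 / C"
  shows "(\<lambda>k. complex_of_real (moment M X k) / fact k * z ^ k) sums cmgf M X z"
proof -
  have "(CLINT x|M. 1 * complex_of_real (X x ^ k)) = of_real (moment M X k)" for k
    unfolding moment_def mult_1 by (rule integral_complex_of_real)
  then show ?thesis
    using exp_expectation_sums[OF assms, of "\<lambda>_. 1"] unfolding cmgf_def by (simp del: of_real_power)
qed

text \<open>The discs of radius \<open>1 / C\<close> around the points of the imaginary axis cover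
  the strip, and on each of them a power series is available.\<close>

lemma (in prob_space) cmgf_holomorphic:
  assumes X: "factorial_moments M X C"
  shows "cmgf M X holomorphic_on {z. \<bar>Re z\<bar> < 1 / C}"
proof -
  have [measurable]: "X \<in> borel_measurable M" and C: "0 < C"
    using X by (auto simp: factorial_moments_def)
  have local: "cmgf M X holomorphic_on ball (\<i> * of_real t) (1 / C)" for t
  proof (rule power_series_holomorphic)
    fix w assume "w \<in> ball (\<i> * of_real t) (1 / C)"
    then have "cmod (w - \<i> * of_real t) < 1 / C" by (simp add: dist_norm norm_minus_commute)
    from exp_expectation_sums[OF X this, of "\<lambda>x. iexp (t * X x)"]
    show "(\<lambda>k. (CLINT x|M. iexp (t * X x) * complex_of_real (X x ^ k)) / fact k * (w - \<i> * of_real t) ^ k) sums cmgf M X w"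
      unfolding cmgf_def by (simp add: exp_add[symmetric] algebra_simps)
  qed
  have "\<exists>t. z \<in> ball (\<i> * of_real t) (1 / C)" if "\<bar>Re z\<bar> < 1 / C" for z
  proof
    have "\<i> * of_real (Im z) - z = - of_real (Re z)" by (simp add: complex_eq_iff)
    then show "z \<in> ball (\<i> * of_real (Im z)) (1 / C)" using that by (simp add: dist_norm)
  qed
  then have "{z. \<bar>Re z\<bar> < 1 / C} \<subseteq> (\<Union>t. ball (\<i> * of_real t) (1 / C))" by blast
  moreover have "cmgf M X holomorphic_on (\<Union>t. ball (\<i> * of_real t) (1 / C))"
    by (rule holomorphic_on_UN_open) (auto intro: local)
  ultimately show ?thesis by (rule holomorphic_on_subset[rotated])
qed

text \<open>Equal moments give equal power series around 0. Analytic continuation spreads the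
  equality over the strip, which contains the imaginary axis, where the values are those of the
  characteristic functions.\<close>

lemma distr_eqI_moments:
  assumes "prob_space M" "prob_space P"
    and X: "factorial_moments M X C" and Y: "factorial_moments P Y C"
    and eq: "\<And>k. moment M X k = moment P Y k"
  shows "distr M borel X = distr P borel Y"
proof (rule Levy_uniqueness)
  interpret M: prob_space M by fact
  interpret P: prob_space P by fact
  have [measurable]: "X \<in> borel_measurable M" "Y \<in> borel_measurable P" and C: "0 < C"
    using X Y by (auto simp: factorial_moments_def)
  show "real_distribution (distr M borel X)" "real_distribution (distr P borel Y)"
    by (auto intro: M.real_distribution_distr P.real_distribution_distr)
  let ?S = "{z. \<bar>Re z\<bar> < 1 / C}"
  have S: "?S = {z. - (1 / C) < Re z} \<inter> {z. Re z < 1 / C}" by auto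
  have opn: "open ?S" unfolding S by (intro open_Int open_halfspace_Re_gt open_halfspace_Re_lt)
  have con: "connected ?S" unfolding S
    by (intro convex_connected convex_Int convex_halfspace_Re_gt convex_halfspace_Re_lt)
  have eq_ball: "cmgf M X z = cmgf P Y z" if "z \<in> ball 0 (1 / C)" for z
    using M.cmgf_sums[OF X] P.cmgf_sums[OF Y] that eq by (auto intro: sums_unique2)
  have sub: "ball 0 (1 / C) \<subseteq> ?S"
    by (auto intro: le_less_trans[OF abs_Re_le_cmod])
  have ne: "ball 0 (1 / C) \<noteq> ({} :: complex set)" using C by simp
  have "cmgf M X z = cmgf P Y z" if "z \<in> ?S" for z
    using eq_ball that
    by (rule analytic_continuation_open[OF open_ball opn ne con sub M.cmgf_holomorphic[OF X] P.cmgf_holomorphic[OF Y]])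
  then show "char (distr M borel X) = char (distr P borel Y)"
    using C by (intro ext) (simp add: M.char_eq_cmgf P.char_eq_cmgf)
qed

text \<open>\<open>cumulant\<close> iterates derivatives along the real line, while the logarithm is
  analytic on a complex disc; each derivative brings out a factor i. The claim covers a whole
  interval because the next derivative needs it in a neighbourhood.\<close>

lemma vector_derivative_iterates:
  fixes L :: "complex \<Rightarrow> complex"
  assumes L: "L holomorphic_on ball 0 \<delta>" and f: "\<And>t. \<bar>t\<bar> < \<delta> \<Longrightarrow> f t = L (\<i> * of_real t)"
    and t: "\<bar>t\<bar> < \<delta>"
  shows "((\<lambda>g t. vector_derivative g (at t)) ^^ k) f t = \<i> ^ k * (deriv ^^ k) L (\<i> * of_real t)"
  using t
proof (induction k arbitrary: t)
  case 0
  then show ?case using f by simp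
next
  case (Suc k)
  let ?V = "(\<lambda>g t. vector_derivative g (at t)) :: (real \<Rightarrow> complex) \<Rightarrow> real \<Rightarrow> complex"
  let ?D = "(deriv ^^ k) L"
  have "?D holomorphic_on ball 0 \<delta>" using L by (intro holomorphic_higher_deriv) auto
  then have D: "(?D has_field_derivative deriv ?D (\<i> * of_real t)) (at (\<i> * of_real t))"
    using Suc.prems by (intro holomorphic_derivI[of _ "ball 0 \<delta>"]) (auto simp: norm_mult)
  have "((\<lambda>s. \<i> * complex_of_real s) has_vector_derivative \<i> * of_real 1) (at t)"
    by (intro has_vector_derivative_mult_right has_vector_derivative_of_real)
      (auto intro: DERIV_ident)
  from field_vector_diff_chain_at[OF this D]
  have "((\<lambda>s. ?D (\<i> * of_real s)) has_vector_derivative \<i> * deriv ?D (\<i> * of_real t)) (at t)"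
    by (simp add: comp_def)
  then have "((\<lambda>s. \<i> ^ k * ?D (\<i> * of_real s)) has_vector_derivative \<i> ^ k * (\<i> * deriv ?D (\<i> * of_real t))) (at t)"
    by (rule has_vector_derivative_mult_right)
  then have "((?V ^^ k) f has_vector_derivative \<i> ^ k * (\<i> * deriv ?D (\<i> * of_real t))) (at t)"
    by (rule has_vector_derivative_transform_within_open[where S = "{-\<delta><..<\<delta>}"])
      (use Suc in \<open>auto simp: abs_less_iff\<close>)
  then show ?case by (simp add: vector_derivative_at mult_ac)
qed

text \<open>Near 0 the generating function stays within distance 1 of its value 1, so it avoids the
  cut of \<open>Ln\<close> and L = Ln \<phi> is holomorphic. Applying Leibniz' rule to \<phi>' = L'
  \<phi> at 0 shows that the derivatives of L satisfy the recursion, and its solution is unique. The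
  powers of i from the chain rule cancel those of \<open>- \<i>\<close> in the definition.\<close>

lemma (in prob_space) cumulant_eq:
  assumes X: "factorial_moments M X C" and rec: "moment_cumulant_rec (moment M X) \<kappa>"
  shows "cumulant M X (Suc n) = \<kappa> (Suc n)"
proof -
  let ?\<phi> = "cmgf M X"
  have [measurable]: "X \<in> borel_measurable M" and C: "0 < C"
    using X by (auto simp: factorial_moments_def)
  have hol: "?\<phi> holomorphic_on ball 0 (1 / C)"
    by (rule holomorphic_on_subset[OF cmgf_holomorphic[OF X]])
      (auto intro: le_less_trans[OF abs_Re_le_cmod])
  have \<phi>0: "?\<phi> 0 = 1" by (simp add: cmgf_def prob_space)
  have "continuous_on (ball 0 (1 / C)) ?\<phi>" using hol by (rule holomorphic_on_imp_continuous_on)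
  then have "continuous (at 0) ?\<phi>" using C by (simp add: continuous_on_eq_continuous_at)
  then have "\<forall>\<epsilon>>0. \<exists>d>0. \<forall>z. dist z 0 < d \<longrightarrow> dist (?\<phi> z) (?\<phi> 0) < \<epsilon>"
    unfolding continuous_at_eps_delta .
  from spec[OF this, of 1]
  obtain d where d: "0 < d" "\<And>z. dist z 0 < d \<Longrightarrow> dist (?\<phi> z) (?\<phi> 0) < 1"
    by auto
  define \<delta> where "\<delta> = min d (1 / C)"
  have \<delta>: "0 < \<delta>" using d C by (simp add: \<delta>_def)
  have hol\<delta>: "?\<phi> holomorphic_on ball 0 \<delta>"
    by (rule holomorphic_on_subset[OF hol]) (auto simp: \<delta>_def)
  have nonpos: "?\<phi> z \<notin> \<real>\<^sub>\<le>\<^sub>0" if "z \<in> ball 0 \<delta>" for z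
  proof -
    have "cmod (?\<phi> z - 1) < 1" using d(2)[of z] that \<phi>0 by (simp add: \<delta>_def dist_norm)
    then have "\<bar>Re (?\<phi> z - 1)\<bar> < 1" using abs_Re_le_cmod le_less_trans by blast
    then have "0 < Re (?\<phi> z)" by simp
    then show ?thesis by (auto simp: complex_nonpos_Reals_iff)
  qed
  define L where "L = (\<lambda>z. Ln (?\<phi> z))"
  have holL: "L holomorphic_on ball 0 \<delta>"
    unfolding L_def using nonpos by (intro holomorphic_on_Ln' hol\<delta>) auto
  have der: "deriv ?\<phi> z = deriv L z * ?\<phi> z" if z: "z \<in> ball 0 \<delta>" for z
  proof -
    have "(?\<phi> has_field_derivative deriv ?\<phi> z) (at z)"
      using hol\<delta> z by (intro holomorphic_derivI) auto
    from DERIV_chain2[OF has_field_derivative_Ln[OF nonpos[OF z]] this]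
    have "deriv L z = inverse (?\<phi> z) * deriv ?\<phi> z" unfolding L_def by (rule DERIV_imp_deriv)
    moreover have "?\<phi> z \<noteq> 0" using nonpos[OF z] by auto
    ultimately show ?thesis by simp
  qed
  have coeff: "(deriv ^^ k) ?\<phi> 0 = of_real (moment M X k)" for k
  proof -
    have "?\<phi> has_fps_expansion Abs_fps (\<lambda>k. complex_of_real (moment M X k) / fact k)"
    proof (rule has_fps_expansionI)
      have "eventually (\<lambda>u. u \<in> ball 0 (1 / C)) (nhds (0 :: complex))"
        using C by (intro eventually_nhds_in_open) auto
      then show "eventually (\<lambda>u. (\<lambda>n. fps_nth (Abs_fps (\<lambda>k. complex_of_real (moment M X k) / fact k)) n * u ^ n) sums ?\<phi> u) (nhds 0)"
        by eventually_elim (use cmgf_sums[OF X] in auto)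
    qed
    from fps_nth_fps_expansion[OF this, of k] show ?thesis by simp
  qed
  have "moment_cumulant_rec (\<lambda>k. complex_of_real (moment M X k)) (\<lambda>k. (deriv ^^ k) L 0)"
    unfolding moment_cumulant_rec_def
  proof (intro conjI allI)
    show "complex_of_real (moment M X 0) = 1" by (simp add: moment_def prob_space)
    fix n
    have "complex_of_real (moment M X (Suc n)) = (deriv ^^ n) (deriv ?\<phi>) 0"
      unfolding coeff[symmetric] by (simp only: funpow_Suc_right comp_apply)
    also have "\<dots> = (deriv ^^ n) (\<lambda>z. deriv L z * ?\<phi> z) 0"
      by (rule higher_deriv_transform_within_open[where S = "ball 0 \<delta>"])
        (use \<delta> der in \<open>auto intro!: holomorphic_deriv holomorphic_on_mult holL hol\<delta>\<close>)
    also have "\<dots> = (\<Sum>i = 0..n. of_nat (n choose i) * (deriv ^^ i) (deriv L) 0 * (deriv ^^ (n - i)) ?\<phi> 0)"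
      by (rule higher_deriv_mult[where S = "ball 0 \<delta>"])
        (use \<delta> in \<open>auto intro!: holomorphic_deriv holL hol\<delta>\<close>)
    also have "\<dots> = (\<Sum>i\<le>n. of_nat (n choose i) * (deriv ^^ Suc i) L 0 * of_real (moment M X (n - i)))"
      by (simp only: coeff funpow_Suc_right comp_apply atMost_atLeast0)
    finally show "complex_of_real (moment M X (Suc n)) = (\<Sum>i\<le>n. of_nat (n choose i) * (deriv ^^ Suc i) L 0 * of_real (moment M X (n - i)))" .
  qed
  moreover have "moment_cumulant_rec (\<lambda>k. complex_of_real (moment M X k)) (\<lambda>k. complex_of_real (\<kappa> k))"
    using rec unfolding moment_cumulant_rec_def by simp
  ultimately have *: "(deriv ^^ Suc n) L 0 = of_real (\<kappa> (Suc n))"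
    by (rule cumulants_unique)
  have "((\<lambda>g t. vector_derivative g (at t)) ^^ Suc n) (\<lambda>t::real. Ln (char (distr M borel X) t)) 0
    = \<i> ^ Suc n * (deriv ^^ Suc n) L (\<i> * of_real 0)"
    by (rule vector_derivative_iterates[OF holL]) (use \<delta> in \<open>auto simp: L_def char_eq_cmgf\<close>)
  also have "\<dots> = \<i> ^ Suc n * of_real (\<kappa> (Suc n))" using * by simp
  finally have "cumulant M X (Suc n) = Re ((- \<i>) ^ Suc n * (\<i> ^ Suc n * of_real (\<kappa> (Suc n))))"
    unfolding cumulant_def by (simp only:)
  also have "(- \<i>) ^ Suc n * (\<i> ^ Suc n * complex_of_real (\<kappa> (Suc n))) = (- \<i> * \<i>) ^ Suc n * of_real (\<kappa> (Suc n))"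
    by (simp only: power_mult_distrib mult.assoc)
  finally show ?thesis by simp
qed

section \<open>The second chaos and the product of two normal variables\<close>

lemma (in prob_space) std_normal_all_moments:
  assumes "distributed M lborel X std_normal_density"
  shows "all_moments M X"
proof (rule gaussian_rv_all_moments)
  have "X \<in> borel_measurable M" using distributed_measurable[OF assms] by simp
  moreover have "\<exists>m s. 0 < s \<and> distributed M lborel X (normal_density m s)"
    by (rule exI[of _ 0], rule exI[of _ 1]) (simp add: assms)
  ultimately show "gaussian_rv M X"
    unfolding gaussian_rv_def by (intro conjI disjI2)
qed

lemma (in prob_space) std_normal_moment:
  assumes D: "distributed M lborel X std_normal_density"
  shows "moment M X (2 * k) = fact (2 * k) / (2 ^ k * fact k)" and "moment M X (2 * k + 1) = 0"
proof -
  have "moment M X n = (\<integral>x. std_normal_density x * x ^ n \<partial>lborel)" for n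
    unfolding moment_def using distributed_integral[OF D, of "\<lambda>x. x ^ n"] by simp
  then show "moment M X (2 * k) = fact (2 * k) / (2 ^ k * fact k)" "moment M X (2 * k + 1) = 0"
    by (simp_all only: integral_std_normal_moment_even integral_std_normal_moment_odd)
qed

lemma (in prob_space) std_normal_moment_Suc_Suc:
  assumes D: "distributed M lborel X std_normal_density"
  shows "moment M X (Suc (Suc k)) = real (Suc k) * moment M X k"
proof (cases "even k")
  case True
  then obtain l where l: "k = 2 * l" by (elim evenE)
  have "Suc (Suc k) = 2 * Suc l" using l by simp
  then have "moment M X (Suc (Suc k)) = fact (2 * Suc l) / (2 ^ Suc l * fact (Suc l))"
    using std_normal_moment(1)[OF D, of "Suc l"] by simp
  also have "fact (2 * Suc l) = real (2 * l + 2) * (real (2 * l + 1) * fact (2 * l))"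
    by (simp add: algebra_simps)
  also have "2 ^ Suc l * fact (Suc l) = real (2 * l + 2) * (2 ^ l * fact l)"
    by (simp add: algebra_simps)
  also have "real (2 * l + 2) * (real (2 * l + 1) * fact (2 * l)) / (real (2 * l + 2) * (2 ^ l * fact l))
      = real (2 * l + 1) * (fact (2 * l) / (2 ^ l * fact l))"
    by (subst mult_divide_mult_cancel_left) auto
  finally show ?thesis using std_normal_moment(1)[OF D, of l] l by simp
next
  case False
  then obtain l where l: "k = 2 * l + 1" by (elim oddE)
  have "Suc (Suc k) = 2 * Suc l + 1" using l by simp
  then show ?thesis using std_normal_moment(2)[OF D, of l] std_normal_moment(2)[OF D, of "Suc l"] l by simp
qed

locale std_normal_pair = prob_space P for P :: "'b measure" +
  fixes N1 N2 :: "'b \<Rightarrow> real"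
  assumes N1: "distributed P lborel N1 std_normal_density"
    and N2: "distributed P lborel N2 std_normal_density"
    and indep: "indep_var borel N1 borel N2"
begin

lemma product_all_moments: "all_moments P (\<lambda>\<omega>. N1 \<omega> * N2 \<omega>)"
  by (rule all_moments_mult[OF std_normal_all_moments[OF N1] std_normal_all_moments[OF N2]])

lemma product_moment: "moment P (\<lambda>\<omega>. N1 \<omega> * N2 \<omega>) k = moment P N1 k * moment P N2 k"
proof -
  have "indep_var borel ((\<lambda>x. x ^ k) \<circ> N1) borel ((\<lambda>x. x ^ k) \<circ> N2)"
    by (rule indep_var_compose[OF indep]) auto
  then have "indep_var borel (\<lambda>\<omega>. N1 \<omega> ^ k) borel (\<lambda>\<omega>. N2 \<omega> ^ k)" by (simp add: comp_def)
  moreover have "integrable P (\<lambda>\<omega>. N1 \<omega> ^ k)" "integrable P (\<lambda>\<omega>. N2 \<omega> ^ k)"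
    by (rule all_moments_integrable[OF all_moments_power[OF std_normal_all_moments[OF N1]]],
      rule all_moments_integrable[OF all_moments_power[OF std_normal_all_moments[OF N2]]])
  ultimately show ?thesis
    unfolding moment_def power_mult_distrib by (rule indep_var_lebesgue_integral)
qed

lemma product_rec: "moment_cumulant_rec (moment P (\<lambda>\<omega>. N1 \<omega> * N2 \<omega>)) (\<lambda>k. if even k then fact (k - 1) else 0)"
proof (rule moment_cumulant_rec_normal_product)
  show "moment P (\<lambda>\<omega>. N1 \<omega> * N2 \<omega>) 0 = 1" by (simp add: moment_def prob_space)
  show "moment P (\<lambda>\<omega>. N1 \<omega> * N2 \<omega>) 1 = 0"
    using std_normal_moment(2)[OF N1, of 0] by (simp add: product_moment)
  show "moment P (\<lambda>\<omega>. N1 \<omega> * N2 \<omega>) (Suc (Suc n)) = (real (Suc n))\<^sup>2 * moment P (\<lambda>\<omega>. N1 \<omega> * N2 \<omega>) n" for n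
    unfolding product_moment std_normal_moment_Suc_Suc[OF N1] std_normal_moment_Suc_Suc[OF N2] power2_eq_square
    by (simp only: mult_ac)
qed

lemma product_factorial_moments:
  assumes "1 \<le> C"
  shows "factorial_moments P (\<lambda>\<omega>. N1 \<omega> * N2 \<omega>) C"
proof (rule factorial_momentsI[OF product_all_moments])
  fix k
  have "\<bar>moment P (\<lambda>\<omega>. N1 \<omega> * N2 \<omega>) k\<bar> \<le> fact k * 1 ^ k"
    by (rule moment_bound[OF product_rec]) auto
  also have "\<dots> \<le> fact k * C ^ k"
    using assms by (intro mult_left_mono power_mono) auto
  finally show "\<bar>moment P (\<lambda>\<omega>. N1 \<omega> * N2 \<omega>) k\<bar> \<le> fact k * C ^ k" .
qed (use assms in simp)

end

section \<open>Passage from the quadratic forms to an element of the second chaos, and the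
  conclusion\<close>

lemma moment_2_eq_cumulant:
  assumes "moment_cumulant_rec m \<kappa>" "\<kappa> (Suc 0) = 0"
  shows "m 2 = \<kappa> 2"
  using assms moment_cumulant_rec_Suc[OF assms(1), of 1] by (simp add: numeral_2_eq_2)

text \<open>All that is used later about the chaos. Convergence in mean square bounds the second
  moments of the approximating forms by \<open>V\<close>; as these are
  \<open>2 * (\<Sum>i<N j. (e j i)\<^sup>2)\<close>, power sums, cumulants and moments are bounded
  uniformly in \<open>j\<close>, and \<open>L2_limit_moments\<close> applies.\<close>

lemma second_chaos_moments:
  assumes iso: "isonormal_process M W" and F: "F \<in> second_wiener_chaos M W"
  obtains \<kappa> :: "nat \<Rightarrow> real" and N :: "nat \<Rightarrow> nat" and e :: "nat \<Rightarrow> nat \<Rightarrow> real" and C :: real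
  where "all_moments M F" and "moment_cumulant_rec (moment M F) \<kappa>" and "\<kappa> (Suc 0) = 0"
    and "\<And>k. 2 \<le> k \<Longrightarrow> (\<lambda>j. 2 ^ (k - 1) * fact (k - 1) * (\<Sum>i<N j. e j i ^ k)) \<longlonglongrightarrow> \<kappa> k"
    and "1 \<le> C" and "\<And>k. \<bar>moment M F k\<bar> \<le> fact k * C ^ k"
proof -
  interpret gaussian_process M W
    using iso unfolding isonormal_process_def
    by (intro gaussian_process.intro gaussian_process_axioms.intro) auto
  obtain f where "is_double_wiener_integral M W f F"
    using F unfolding second_wiener_chaos_def by blast
  then obtain N :: "nat \<Rightarrow> nat" and c h where FM [measurable]: "F \<in> borel_measurable M" and F2: "integrable M (\<lambda>\<omega>. (F \<omega>)\<^sup>2)"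
    and lim: "(\<lambda>n. \<integral>\<omega>. (F \<omega> - (\<Sum>k<N n. c n k * ((W (h n k) \<omega>)\<^sup>2 - (norm (h n k))\<^sup>2)))\<^sup>2 \<partial>M) \<longlonglongrightarrow> 0"
    unfolding is_double_wiener_integral_def by blast
  have gq: "gaussian_quadratic M W" by unfold_locales
  define Q where "Q j = gaussian_quadratic.quad W (N j) (c j) (h j)" for j
  define \<kappa>Q where "\<kappa>Q j = gaussian_quadratic.quad_cumulant (N j) (c j) (h j)" for j
  have Qam: "all_moments M (Q j)" for j
    unfolding Q_def by (rule gaussian_quadratic.all_moments_quad[OF gq])
  have Qrec: "moment_cumulant_rec (moment M (Q j)) (\<kappa>Q j)" for j
    unfolding Q_def \<kappa>Q_def by (rule gaussian_quadratic.quad_moment_cumulant_rec[OF gq])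
  have "\<forall>j. \<exists>e :: nat \<Rightarrow> real. \<forall>k\<ge>2. \<kappa>Q j k = 2 ^ (k - 1) * fact (k - 1) * (\<Sum>i<N j. e i ^ k)"
    unfolding \<kappa>Q_def by (intro allI gaussian_quadratic.quad_cumulant_eigenvalues[OF gq])
  then obtain e :: "nat \<Rightarrow> nat \<Rightarrow> real" where
    e: "\<And>j k. 2 \<le> k \<Longrightarrow> \<kappa>Q j k = 2 ^ (k - 1) * fact (k - 1) * (\<Sum>i<N j. e j i ^ k)"
    by metis
  have \<kappa>Q1: "\<kappa>Q j (Suc 0) = 0" for j
    unfolding \<kappa>Q_def by (simp add: gaussian_quadratic.quad_cumulant_def[OF gq])
  have limQ: "(\<lambda>j. expectation (\<lambda>\<omega>. (F \<omega> - Q j \<omega>)\<^sup>2)) \<longlonglongrightarrow> 0"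
    using lim unfolding Q_def gaussian_quadratic.quad_def[OF gq] .
  have iQ2: "integrable M (\<lambda>\<omega>. (Q j \<omega>)\<^sup>2)" for j
    by (intro all_moments_integrable all_moments_power Qam)
  have QM [measurable]: "Q j \<in> borel_measurable M" for j
    using Qam by (rule all_moments_measurable)
  obtain K where K: "\<And>j. \<bar>expectation (\<lambda>\<omega>. (F \<omega> - Q j \<omega>)\<^sup>2)\<bar> \<le> K"
    using convergent_imp_Bseq[OF convergentI[OF limQ]] by (auto simp: Bseq_def)
  define V where "V = 2 * expectation (\<lambda>\<omega>. (F \<omega>)\<^sup>2) + 2 * K"
  have m2: "moment M (Q j) 2 \<le> V" for j
  proof -
    have pt: "(Q j \<omega>)\<^sup>2 \<le> 2 * (F \<omega>)\<^sup>2 + 2 * (F \<omega> - Q j \<omega>)\<^sup>2"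
      and pt': "(F \<omega> - Q j \<omega>)\<^sup>2 \<le> 2 * (F \<omega>)\<^sup>2 + 2 * (Q j \<omega>)\<^sup>2" for \<omega>
    proof -
      have "0 \<le> (2 * F \<omega> - Q j \<omega>)\<^sup>2" "0 \<le> (F \<omega> + Q j \<omega>)\<^sup>2" by simp_all
      then show "(Q j \<omega>)\<^sup>2 \<le> 2 * (F \<omega>)\<^sup>2 + 2 * (F \<omega> - Q j \<omega>)\<^sup>2" "(F \<omega> - Q j \<omega>)\<^sup>2 \<le> 2 * (F \<omega>)\<^sup>2 + 2 * (Q j \<omega>)\<^sup>2"
        by (simp_all add: power2_eq_square algebra_simps)
    qed
    have iD: "integrable M (\<lambda>\<omega>. (F \<omega> - Q j \<omega>)\<^sup>2)"
    proof (rule Bochner_Integration.integrable_bound)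
      show "integrable M (\<lambda>\<omega>. 2 * (F \<omega>)\<^sup>2 + 2 * (Q j \<omega>)\<^sup>2)" using F2 iQ2 by simp
      show "AE \<omega> in M. norm ((F \<omega> - Q j \<omega>)\<^sup>2) \<le> norm (2 * (F \<omega>)\<^sup>2 + 2 * (Q j \<omega>)\<^sup>2)"
        using pt' by simp
    qed simp
    have "moment M (Q j) 2 \<le> expectation (\<lambda>\<omega>. 2 * (F \<omega>)\<^sup>2 + 2 * (F \<omega> - Q j \<omega>)\<^sup>2)"
      unfolding moment_def using iD F2 iQ2 pt by (intro integral_mono) auto
    also have "\<dots> = 2 * expectation (\<lambda>\<omega>. (F \<omega>)\<^sup>2) + 2 * expectation (\<lambda>\<omega>. (F \<omega> - Q j \<omega>)\<^sup>2)"
      using iD F2 by simp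
    finally show ?thesis using K[of j] by (simp add: V_def)
  qed
  have sq: "(\<Sum>i<N j. (e j i)\<^sup>2) \<le> V" for j
  proof -
    have "2 * (\<Sum>i<N j. (e j i)\<^sup>2) \<le> V"
      using m2[of j] moment_2_eq_cumulant[OF Qrec \<kappa>Q1, of j] e[of 2 j] by simp
    moreover have "0 \<le> (\<Sum>i<N j. (e j i)\<^sup>2)" by (simp add: sum_nonneg)
    ultimately show ?thesis by simp
  qed
  have V0: "0 \<le> V" using sq[of 0] sum_nonneg[of "{..<N 0}" "\<lambda>i. (e 0 i)\<^sup>2"] by simp
  \<comment> \<open>The k-th power sums are at most \<open>sqrt V ^ k\<close>, and
    \<open>2 * sqrt V\<close> absorbs the factor \<open>2 ^ (k - 1)\<close> of the cumulants. Adding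
    1 gives \<open>1 \<le> C\<close>, as \<open>product_factorial_moments\<close> demands.\<close>
  define C where "C = 2 * sqrt V + 1"
  have C: "1 \<le> C" using V0 by (simp add: C_def)
  have \<kappa>b: "\<bar>\<kappa>Q j (Suc n)\<bar> \<le> fact n * C ^ Suc n" for j n
  proof (cases n)
    case 0
    then show ?thesis using \<kappa>Q1 C by simp
  next
    case (Suc l)
    have "\<bar>\<Sum>i<N j. e j i ^ Suc n\<bar> \<le> sqrt (\<Sum>i<N j. (e j i)\<^sup>2) ^ Suc n"
      using Suc by (intro abs_power_sum_le) auto
    also have "\<dots> \<le> sqrt V ^ Suc n"
      using sq by (intro power_mono) (auto simp: sum_nonneg)
    finally have *: "\<bar>\<Sum>i<N j. e j i ^ Suc n\<bar> \<le> sqrt V ^ Suc n" .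
    have "\<bar>\<kappa>Q j (Suc n)\<bar> = 2 ^ n * fact n * \<bar>\<Sum>i<N j. e j i ^ Suc n\<bar>"
      using e[of "Suc n" j] Suc by (simp add: abs_mult del: power_Suc fact_Suc)
    also have "\<dots> \<le> 2 ^ Suc n * fact n * sqrt V ^ Suc n"
      using * V0 by (intro mult_mono) auto
    also have "\<dots> = fact n * (2 * sqrt V) ^ Suc n"
      by (simp only: power_mult_distrib mult_ac)
    also have "\<dots> \<le> fact n * C ^ Suc n"
      using V0 by (intro mult_left_mono power_mono) (auto simp: C_def)
    finally show ?thesis .
  qed
  have mb: "\<bar>moment M (Q j) k\<bar> \<le> fact k * C ^ k" for j k
    using C by (intro moment_bound[OF Qrec _ \<kappa>b]) simp
  have mb2: "moment M (Q j) (2 * k) \<le> fact (2 * k) * C ^ (2 * k)" for j k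
    using mb[of j "2 * k"] by simp
  have Fam: "all_moments M F" and mlim: "\<And>k. (\<lambda>j. moment M (Q j) k) \<longlonglongrightarrow> moment M F k"
    using L2_limit_moments[OF Qam FM F2 limQ mb2] by blast+
  obtain \<kappa> where rec: "moment_cumulant_rec (moment M F) \<kappa>" and \<kappa>lim: "\<And>n. (\<lambda>j. \<kappa>Q j (Suc n)) \<longlonglongrightarrow> \<kappa> (Suc n)"
    using tendsto_cumulants[of "\<lambda>j. moment M (Q j)" \<kappa>Q "moment M F"] Qrec mlim by blast
  show thesis
  proof (rule that[OF Fam rec _ _ C])
    show "\<kappa> (Suc 0) = 0" using \<kappa>lim[of 0] unfolding \<kappa>Q1 LIMSEQ_const_iff by (rule sym)
    show "(\<lambda>j. 2 ^ (k - 1) * fact (k - 1) * (\<Sum>i<N j. e j i ^ k)) \<longlonglongrightarrow> \<kappa> k" if "2 \<le> k" for k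
    proof -
      obtain n where "k = Suc n" using \<open>2 \<le> k\<close> by (cases k) auto
      then show ?thesis using \<kappa>lim[of n] e[OF that] by simp
    qed
    show "\<bar>moment M F k\<bar> \<le> fact k * C ^ k" for k
      by (rule LIMSEQ_le_const2[OF tendsto_rabs[OF mlim]]) (use mb in blast)
  qed
qed

lemma symmetric_odd_moment:
  assumes [measurable]: "F \<in> borel_measurable M"
    and sym: "distr M borel F = distr M borel (\<lambda>\<omega>. - F \<omega>)" and "odd k"
  shows "moment M F k = 0"
proof -
  have "moment M F k = (\<integral>y. y ^ k \<partial>distr M borel F)"
    unfolding moment_def by (subst integral_distr) auto
  also have "\<dots> = (\<integral>\<omega>. (- F \<omega>) ^ k \<partial>M)"
    unfolding sym by (subst integral_distr) auto
  also have "\<dots> = - moment M F k"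
    using \<open>odd k\<close> by (simp add: moment_def power_minus_odd)
  finally show ?thesis by simp
qed

theorem proposition3p6:
  fixes M :: "'a measure"
    and W :: "'h::{real_inner, polish_space} \<Rightarrow> 'a \<Rightarrow> real"
    and F :: "'a \<Rightarrow> real"
    and P :: "'b measure"
    and N1 N2 :: "'b \<Rightarrow> real"
  assumes "isonormal_process M W"
    and "F \<in> second_wiener_chaos M W"
    and "distr M borel F = distr M borel (\<lambda>\<omega>. - F \<omega>)"
    and "(\<integral>\<omega>. (F \<omega>)\<^sup>2 \<partial>M) \<le> 1"
    and "prob_space P"
    and "distributed P lborel N1 std_normal_density"
    and "distributed P lborel N2 std_normal_density"
    and "prob_space.indep_var P borel N1 borel N2"
  shows "(\<forall>r\<ge>1. cumulant M F (2 * r) \<le> cumulant P (\<lambda>\<omega>. N1 \<omega> * N2 \<omega>) (2 * r)) \<and>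
    (\<forall>r\<ge>1. moment M F (2 * r) \<le> moment P (\<lambda>\<omega>. N1 \<omega> * N2 \<omega>) (2 * r)) \<and>
    (\<forall>r\<ge>2. cumulant M F (2 * r) = cumulant P (\<lambda>\<omega>. N1 \<omega> * N2 \<omega>) (2 * r) \<or>
            moment M F (2 * r) = moment P (\<lambda>\<omega>. N1 \<omega> * N2 \<omega>) (2 * r)
       \<longrightarrow> distr M borel F = distr P borel (\<lambda>\<omega>. N1 \<omega> * N2 \<omega>))"
proof -
  interpret M: prob_space M using assms(1) by (simp add: isonormal_process_def)
  interpret N: std_normal_pair P N1 N2
    using assms(5-8) by (intro std_normal_pair.intro std_normal_pair_axioms.intro) auto
  let ?X = "\<lambda>\<omega>. N1 \<omega> * N2 \<omega>"
  let ?\<kappa>N = "\<lambda>k. if even k then fact (k - 1) else 0 :: real"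
  obtain \<kappa> and N :: "nat \<Rightarrow> nat" and e C where Fam: "all_moments M F" and rec: "moment_cumulant_rec (moment M F) \<kappa>"
    and \<kappa>1: "\<kappa> (Suc 0) = 0"
    and lim: "\<And>k. 2 \<le> k \<Longrightarrow> (\<lambda>j. 2 ^ (k - 1) * fact (k - 1) * (\<Sum>i<N j. e j i ^ k)) \<longlonglongrightarrow> \<kappa> k"
    and C: "1 \<le> C" and mF: "\<And>k. \<bar>moment M F k\<bar> \<le> fact k * C ^ k"
    by (rule second_chaos_moments[OF assms(1,2)]) (rule that)
  have FM: "F \<in> borel_measurable M" using Fam by (rule M.all_moments_measurable)
  have FF: "factorial_moments M F C" using C by (intro M.factorial_momentsI Fam mF) simp
  have XF: "factorial_moments P ?X C" by (rule N.product_factorial_moments[OF C])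
  have \<kappa>odd: "\<kappa> k = 0" if "odd k" for k
    using symmetric_odd_moment[OF FM assms(3)] that by (rule odd_cumulants_zero[OF rec])
  \<comment> \<open>The cumulants are rescaled to what would be the power sums of the spectrum of
    \<open>F\<close>; they arise here only as limits.\<close>
  define p where "p k = \<kappa> k / (2 ^ (k - 1) * fact (k - 1))" for k
  have \<kappa>p: "\<kappa> k = 2 ^ (k - 1) * fact (k - 1) * p k" for k by (simp add: p_def)
  have plim: "(\<lambda>j. \<Sum>i<N j. e j i ^ k) \<longlonglongrightarrow> p k" if "2 \<le> k" for k
    using tendsto_divide[OF lim[OF that] tendsto_const[of "2 ^ (k - 1) * fact (k - 1)"]] by (simp add: p_def)
  have podd: "p k = 0" if "odd k" "3 \<le> k" for k using \<kappa>odd[OF that(1)] by (simp add: p_def)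
  have p2: "p 2 \<le> 1 / 2"
    using assms(4) moment_2_eq_cumulant[OF rec \<kappa>1] by (simp add: p_def moment_def)
  have p_nonneg: "0 \<le> p (2 * r)" if "1 \<le> r" for r
    by (rule limit_power_sums_le(1)[OF plim podd p2 that])
  have p_le: "p (2 * r) \<le> 2 * (1 / 2) ^ (2 * r)" if "1 \<le> r" for r
    by (rule limit_power_sums_le(2)[OF plim podd p2 that])
  have p_eq: "p (2 * k) = 2 * (1 / 2) ^ (2 * k)" if "2 \<le> r" "p (2 * r) = 2 * (1 / 2) ^ (2 * r)" "1 \<le> k" for r k
    by (rule limit_power_sums_le(3)[OF plim podd p2 that])
  \<comment> \<open>The power sums of the spectrum {1/2, -1/2} turn back into the cumulants of the
    product.\<close>
  have scale: "2 ^ (2 * r - 1) * fact (2 * r - 1) * (2 * (1 / 2) ^ (2 * r)) = (fact (2 * r - 1) :: real)" if "1 \<le> r" for r :: nat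
  proof -
    obtain q where "2 * r = Suc q" using \<open>1 \<le> r\<close> by (cases "2 * r") auto
    then show ?thesis by (simp add: power_one_over)
  qed
  have even: "0 \<le> \<kappa> (2 * r)" "\<kappa> (2 * r) \<le> fact (2 * r - 1)" if "1 \<le> r" for r
  proof -
    show "0 \<le> \<kappa> (2 * r)" unfolding \<kappa>p using p_nonneg[OF that] by simp
    have "\<kappa> (2 * r) \<le> 2 ^ (2 * r - 1) * fact (2 * r - 1) * (2 * (1 / 2) ^ (2 * r))"
      unfolding \<kappa>p using p_le[OF that] by (intro mult_left_mono) auto
    then show "\<kappa> (2 * r) \<le> fact (2 * r - 1)" unfolding scale[OF that] .
  qed
  have nonneg: "0 \<le> \<kappa> (Suc n)" and le: "\<kappa> (Suc n) \<le> ?\<kappa>N (Suc n)" for n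
  proof -
    have "0 \<le> \<kappa> (Suc n) \<and> \<kappa> (Suc n) \<le> ?\<kappa>N (Suc n)"
    proof (cases "even (Suc n)")
      case True
      then obtain r where r: "Suc n = 2 * r" by (elim evenE)
      then have "1 \<le> r" by (cases r) auto
      then show ?thesis using even[of r] unfolding r by simp
    next
      case False
      then show ?thesis using \<kappa>odd by simp
    qed
    then show "0 \<le> \<kappa> (Suc n)" "\<kappa> (Suc n) \<le> ?\<kappa>N (Suc n)" by auto
  qed
  have cum: "cumulant M F (2 * r) = \<kappa> (2 * r)" "cumulant P ?X (2 * r) = fact (2 * r - 1)" if "1 \<le> r" for r
  proof -
    obtain n where n: "2 * r = Suc n" using \<open>1 \<le> r\<close> by (cases "2 * r") auto
    show "cumulant M F (2 * r) = \<kappa> (2 * r)" unfolding n by (rule M.cumulant_eq[OF FF rec])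
    have "cumulant P ?X (2 * r) = ?\<kappa>N (2 * r)" unfolding n by (rule N.cumulant_eq[OF XF N.product_rec])
    then show "cumulant P ?X (2 * r) = fact (2 * r - 1)" by simp
  qed
  have "distr M borel F = distr P borel ?X"
    if r: "2 \<le> r" and eq: "cumulant M F (2 * r) = cumulant P ?X (2 * r) \<or> moment M F (2 * r) = moment P ?X (2 * r)" for r
  proof -
    have r1: "1 \<le> r" using r by simp
    obtain n where n: "2 * r = Suc n" using r by (cases "2 * r") auto
    have "\<kappa> (2 * r) = fact (2 * r - 1)"
      using eq
    proof
      assume "cumulant M F (2 * r) = cumulant P ?X (2 * r)"
      then show ?thesis using cum[OF r1] by simp
    next
      assume "moment M F (2 * r) = moment P ?X (2 * r)"
      then have "\<kappa> (2 * r) = ?\<kappa>N (2 * r)"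
        using moment_eq_imp_cumulant_eq[OF rec N.product_rec nonneg le] unfolding n by blast
      then show ?thesis by simp
    qed
    then have "2 ^ (2 * r - 1) * fact (2 * r - 1) * p (2 * r) = 2 ^ (2 * r - 1) * fact (2 * r - 1) * (2 * (1 / 2) ^ (2 * r))"
      unfolding scale[OF r1] \<kappa>p .
    then have pr: "p (2 * r) = 2 * (1 / 2) ^ (2 * r)" by simp
    have "\<kappa> (Suc n) = ?\<kappa>N (Suc n)" for n
    proof (cases "even (Suc n)")
      case True
      then obtain k where k: "Suc n = 2 * k" by (elim evenE)
      then have "1 \<le> k" by (cases k) auto
      then have "\<kappa> (2 * k) = fact (2 * k - 1)"
        unfolding \<kappa>p[of "2 * k"] using p_eq[OF r pr, of k] scale[of k] by simp
      then show ?thesis unfolding k by simp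
    next
      case False
      then show ?thesis using \<kappa>odd by simp
    qed
    then have "moment M F k = moment P ?X k" for k
      by (rule moments_unique[OF rec N.product_rec])
    then show ?thesis
      by (rule distr_eqI_moments[OF M.prob_space_axioms N.prob_space_axioms FF XF])
  qed
  moreover have "moment M F k \<le> moment P ?X k" for k
    using moments_mono[OF rec N.product_rec nonneg le] by blast
  moreover have "cumulant M F (2 * r) \<le> cumulant P ?X (2 * r)" if "1 \<le> r" for r
    using cum[OF that] even(2)[OF that] by simp
  ultimately show ?thesis by blast
qed

end
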